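(* Let $r\geq 1$ and let $n_1,\ldots,n_r$ be positive integers, $N=n_1+\cdots+n_r$, $K$ a field, $S=K[x_1,\ldots,x_N]$, and $$I=(x_1,\ldots,x_{n_1})\cap(x_{n_1+1},\ldots,x_{n_1+n_2})\cap\cdots\cap(x_{n_1+\cdots+n_{r-1}+1},\ldots,x_N)\subset S.$$ Then $$\left\lfloor\frac{N+r}{2}\right\rfloor\geq \operatorname{hdepth}(I)\geq \operatorname{sdepth}(I)\geq \left\lceil\frac{n_1}{2}\right\rceil+\cdots+\left\lceil\frac{n_r}{2}\right\rceil.$$
   Context: Stanley depth: let $S=K[x_1,\ldots,x_p]$ be a polynomial ring over a field $K$ and $M$ a $\mathbb Z^p$-graded $S$-module. A Stanley decomposition of $M$ is a direct sum decomposition $\mathcal D: M=\bigoplus_{i} m_iK[Z_i]$ (finite sum) as a $\mathbb Z^p$-graded $K$-vector space, where each $m_i\in M$ is homogeneous with respect to the $\mathbb Z^p$-grading, $Z_i\subset\{x_1,\ldots,x_p\}$, and $m_iK[Z_i]=\{um_i: u\in K[Z_i]\}\subset M$ is a free $K[Z_i]$-submodule. Put $\operatorname{sdepth}(\mathcal D)=\min_i|Z_i|$ and $\operatorname{sdepth}(M)=\max\{\operatorname{sdepth}(\mathcal D):\mathcal D$ a Stanley decomposition of $M\}$. Hilbert depth: for a finitely generated graded $S$-module $M$, $\operatorname{hdepth}(M)$ is the maximal depth of a finitely generated graded $S$-module with the same Hilbert series as $M$. For squarefree monomial ideals $A\subset B\subset S$ this is (by a known theorem, usable as the definition) $\operatorname{hdepth}(B/A)=\max\{d\in\{0,\ldots,p\}:\beta_k^d(B/A)\geq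 0\text{ for all }0\leq k\leq d\}$, where $\beta_k^d(B/A)=\sum_{j=0}^k(-1)^{k-j}\binom{d-j}{k-j}\alpha_j(B/A)$ and $\alpha_j(B/A)$ is the number of squarefree monomials of degree $j$ in $B\setminus A$ (for the ideal $I$ itself take $B=I$, $A=0$). *)

theory Defs
  imports "HOL-Algebra.Ideal" "HOL-Library.Poly_Mapping" "HOL-Library.FuncSet" Complex_Main
begin

text \<open>Polynomials in indeterminates indexed by the natural numbers: finitely supported
  functions from exponent vectors to coefficients, with the convolution product
  of \<^theory>\<open>HOL-Library.Poly_Mapping\<close>.\<close>

type_synonym 'k mpoly = "(nat \<Rightarrow>\<^sub>0 nat) \<Rightarrow>\<^sub>0 'k"

definition pvar :: "nat \<Rightarrow> 'k::field mpoly" where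
  "pvar i = Poly_Mapping.single (Poly_Mapping.single i 1) 1"

text \<open>\<open>poly_ring Z\<close> is \<open>K[x\<^sub>i | i \<in> Z]\<close>, for \<open>K\<close> the field given by the type \<open>'k\<close>;
  in particular \<open>S = K[x\<^sub>1, \<dots>, x\<^sub>p]\<close> is \<open>poly_ring {1..p}\<close>.\<close>

definition poly_ring :: "nat set \<Rightarrow> 'k::field mpoly ring" where
  "poly_ring Z =
     \<lparr>carrier = {f. \<forall>a \<in> Poly_Mapping.keys f. Poly_Mapping.keys a \<subseteq> Z},
      mult = (*), one = 1, zero = 0, add = (+)\<rparr>"

lemma poly_ring_simps [simp]:
  "mult (poly_ring Z) = (*)" "one (poly_ring Z) = 1"
  "zero (poly_ring Z) = 0" "add (poly_ring Z) = (+)"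
  by (simp_all add: poly_ring_def)

lemma carrier_poly_ring:
  "f \<in> carrier (poly_ring Z) \<longleftrightarrow> (\<forall>a \<in> Poly_Mapping.keys f. Poly_Mapping.keys a \<subseteq> Z)"
  by (simp add: poly_ring_def)

lemma cring_poly_ring: "cring (poly_ring Z :: 'k::field mpoly ring)"
proof (intro cringI abelian_groupI comm_monoidI)
  fix f g :: "'k mpoly"
  assume f: "f \<in> carrier (poly_ring Z)" and g: "g \<in> carrier (poly_ring Z)"
  show "f \<oplus>\<^bsub>poly_ring Z\<^esub> g \<in> carrier (poly_ring Z)"
    using f g Poly_Mapping.keys_add [of f g] by (auto simp: carrier_poly_ring)
  show "f \<otimes>\<^bsub>poly_ring Z\<^esub> g \<in> carrier (poly_ring Z)"
    unfolding carrier_poly_ring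
  proof
    fix a assume "a \<in> Poly_Mapping.keys (f \<otimes>\<^bsub>poly_ring Z\<^esub> g)"
    then obtain b c where "a = b + c" "b \<in> Poly_Mapping.keys f" "c \<in> Poly_Mapping.keys g"
      using keys_mult [of f g] by auto
    then show "Poly_Mapping.keys a \<subseteq> Z"
      using f g Poly_Mapping.keys_add [of b c] by (fastforce simp: carrier_poly_ring)
  qed
next
  fix f :: "'k mpoly"
  assume f: "f \<in> carrier (poly_ring Z)"
  show "\<exists>y\<in>carrier (poly_ring Z). y \<oplus>\<^bsub>poly_ring Z\<^esub> f = \<zero>\<^bsub>poly_ring Z\<^esub>"
    using f by (intro bexI [of _ "- f"]) (auto simp: carrier_poly_ring)
qed (auto simp: algebra_simps carrier_poly_ring)

text \<open>The \<open>\<int>\<^sup>p\<close>-grading of \<open>S\<close>: the component of degree \<open>a\<close> is \<open>K x\<^sup>a\<close> if \<open>a \<ge> 0\<close>,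
  and is \<open>0\<close> otherwise.\<close>

definition homogeneous :: "'k::field mpoly \<Rightarrow> bool" where
  "homogeneous m \<longleftrightarrow> (\<exists>a. Poly_Mapping.keys m \<subseteq> {a})"

definition stanley_space :: "'k::field mpoly \<Rightarrow> nat set \<Rightarrow> 'k mpoly set" where
  "stanley_space m Z = {u * m | u. u \<in> carrier (poly_ring Z)}"

text \<open>Stanley decompositions of a graded submodule \<open>M\<close> of \<open>S = K[x\<^sub>1, \<dots>, x\<^sub>p]\<close>. A variable is
  represented by its index. The third condition says that \<open>m K[Z]\<close> is free with basis \<open>m\<close>; in
  particular it is nonzero, so no summand can occur twice in a direct sum and a finite set of
  pairs \<open>(m, Z)\<close> represents an arbitrary finite family. The last condition is the direct sum
  decomposition: every element of \<open>M\<close> is a sum of elements of the summands in exactly one way,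
  and all such sums lie in \<open>M\<close>. It respects the grading because each \<open>m\<close> is homogeneous.\<close>

definition stanley_decomposition ::
    "nat \<Rightarrow> 'k::field mpoly set \<Rightarrow> ('k mpoly \<times> nat set) set \<Rightarrow> bool" where
  "stanley_decomposition p M D \<longleftrightarrow>
     finite D \<and>
     (\<forall>(m, Z) \<in> D. m \<in> M \<and> homogeneous m \<and> Z \<subseteq> {1..p}) \<and>
     (\<forall>(m, Z) \<in> D. \<forall>u \<in> carrier (poly_ring Z). u * m = 0 \<longrightarrow> u = 0) \<and>
     bij_betw (\<lambda>g. \<Sum>d\<in>D. g d) (\<Pi>\<^sub>E (m, Z) \<in> D. stanley_space m Z) M"

definition sdepth_decomposition :: "('k::field mpoly \<times> nat set) set \<Rightarrow> nat" where
  "sdepth_decomposition D = Min ((\<lambda>(m, Z). card Z) ` D)"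

text \<open>Meaningful for \<open>M \<noteq> {0}\<close>; the zero module has the empty decomposition.\<close>

definition sdepth :: "nat \<Rightarrow> 'k::field mpoly set \<Rightarrow> nat" where
  "sdepth p M = Max {sdepth_decomposition D | D. stanley_decomposition p M D}"

text \<open>For squarefree monomial ideals \<open>A \<subseteq> B\<close> of \<open>S\<close>, \<open>alpha p B A j\<close> is \<open>\<alpha>\<^sub>j(B/A)\<close>; a squarefree
  monomial is a product of distinct variables. The Hilbert depth is given by its known
  combinatorial characterization for quotients of squarefree monomial ideals.\<close>

definition alpha :: "nat \<Rightarrow> 'k::field mpoly set \<Rightarrow> 'k mpoly set \<Rightarrow> nat \<Rightarrow> nat" where
  "alpha p B A j =
     card {m \<in> B - A. \<exists>T. T \<subseteq> {1..p} \<and> card T = j \<and> m = (\<Prod>i\<in>T. pvar i)}"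

definition beta :: "nat \<Rightarrow> 'k::field mpoly set \<Rightarrow> 'k mpoly set \<Rightarrow> nat \<Rightarrow> nat \<Rightarrow> int" where
  "beta p B A d k =
     (\<Sum>j=0..k. (- 1) ^ (k - j) * int ((d - j) choose (k - j)) * int (alpha p B A j))"

definition hdepth_quotient :: "nat \<Rightarrow> 'k::field mpoly set \<Rightarrow> 'k mpoly set \<Rightarrow> nat" where
  "hdepth_quotient p B A = Max {d \<in> {0..p}. \<forall>k\<le>d. beta p B A d k \<ge> 0}"

definition hdepth :: "nat \<Rightarrow> 'k::field mpoly set \<Rightarrow> nat" where
  "hdepth p I = hdepth_quotient p I {0}"

end

theory Submission
  imports Defs "HOL-Library.Disjoint_Sets"
begin

text \<open>Stanley depth and Hilbert depth of \<open>I\<close> are read off the family \<open>F\<close> of the subsets of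
  \<open>{1..N}\<close> that meet all blocks, the supports of the monomials in \<open>I\<close>. A summand
  \<open>m K[Z]\<close> of a Stanley decomposition of \<open>I\<close> meets \<open>F\<close> in nothing or in an interval \<open>[A, C]\<close> with
  \<open>|C| \<ge> |Z|\<close>, so the decomposition restricts to a partition of \<open>F\<close> into intervals; an interval
  partition gives back a Stanley decomposition with summands \<open>x\<^sup>A K[C]\<close>.

  An interval with \<open>|C| \<ge> d\<close> contributes a nonnegative amount to each \<open>\<beta>\<^sub>k\<^sup>d\<close>, so the Stanley depth
  is at most the Hilbert depth. Since \<open>\<alpha>\<^sub>r > 0\<close> and \<open>2 \<alpha>\<^bsub>r+1\<^esub> \<le> (N - r) \<alpha>\<^sub>r\<close>, the
  inequality \<open>\<beta>\<^bsub>r+1\<^esub>\<^sup>d = \<alpha>\<^bsub>r+1\<^esub> - (d - r) \<alpha>\<^sub>r \<ge> 0\<close> forces \<open>d \<le> (N + r) / 2\<close>.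

  For the lower bound, joining interval partitions over disjoint ground sets adds up the depths, so
  one block of size \<open>n\<close> suffices. For \<open>n\<close> odd, every nonzero cyclic 0/1 word of length \<open>n\<close>
  is in exactly one way a cyclic sequence of the tiles \<open>1\<close>, \<open>00\<close> and \<open>01\<close>. Fixing the positions of
  the tiles leaves one free letter in each tile of length two, which describes an interval whose top
  has one element per tile, so at least \<open>n / 2\<close> elements. For \<open>n\<close> even, split off the sets that
  contain a fixed element; they form a single interval.\<close>

section \<open>Interval partitions\<close>

lemma partition_on_part_unique:
  "partition_on A P \<Longrightarrow> p \<in> P \<Longrightarrow> q \<in> P \<Longrightarrow> x \<in> p \<Longrightarrow> x \<in> q \<Longrightarrow> p = q"
  unfolding partition_on_def pairwise_def disjnt_def by blast

text \<open>The bound is on the tops because \<open>C\<close> becomes the set of free variables of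
  the Stanley space \<open>x^A K[C]\<close>. Parts of a partition are nonempty, so
  \<open>A \<subseteq> C\<close> in each of them. The empty family satisfies the condition for every
  \<open>d\<close>.\<close>

definition has_interval_partition :: "nat \<Rightarrow> 'a set set \<Rightarrow> bool" where
  "has_interval_partition d F \<longleftrightarrow>
     (\<exists>Q. partition_on F Q \<and> (\<forall>P\<in>Q. \<exists>A C. P = {A..C} \<and> finite C \<and> d \<le> card C))"

lemma has_interval_partition_interval:
  assumes "A \<subseteq> C" "finite C" "d \<le> card C"
  shows "has_interval_partition d {A..C}"
  unfolding has_interval_partition_def
  using assms by (intro exI[of _ "{{A..C}}"]) (auto intro!: partition_on_space)

lemma has_interval_partition_mono:
  "has_interval_partition d F \<Longrightarrow> e \<le> d \<Longrightarrow> has_interval_partition e F"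
  unfolding has_interval_partition_def by (meson order_trans)

lemma has_interval_partition_Un:
  assumes "has_interval_partition d F" "has_interval_partition d G" "F \<inter> G = {}"
  shows "has_interval_partition d (F \<union> G)"
proof -
  obtain Q where Q: "partition_on F Q" "\<forall>P\<in>Q. \<exists>A C. P = {A..C} \<and> finite C \<and> d \<le> card C"
    using assms(1) unfolding has_interval_partition_def by blast
  obtain R where R: "partition_on G R" "\<forall>P\<in>R. \<exists>A C. P = {A..C} \<and> finite C \<and> d \<le> card C"
    using assms(2) unfolding has_interval_partition_def by blast
  have "partition_on (F \<union> G) (Q \<union> R)"
  proof (rule partition_onI)
    show "\<Union> (Q \<union> R) = F \<union> G" "{} \<notin> Q \<union> R"
      using Q(1) R(1) by (auto simp: partition_on_def)
    fix p q assume "p \<in> Q \<union> R" "q \<in> Q \<union> R" "p \<noteq> q"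
    show "disjnt p q"
    proof (rule ccontr)
      assume "\<not> disjnt p q"
      then obtain x where x: "x \<in> p" "x \<in> q" unfolding disjnt_def by blast
      then have "p \<in> Q \<and> q \<in> Q \<or> p \<in> R \<and> q \<in> R"
        using \<open>p \<in> Q \<union> R\<close> \<open>q \<in> Q \<union> R\<close> partition_onD1[OF Q(1)] partition_onD1[OF R(1)] assms(3)
        by blast
      then show False
        using x \<open>p \<noteq> q\<close> partition_on_part_unique[OF Q(1), of p q x]
          partition_on_part_unique[OF R(1), of p q x] by blast
    qed
  qed
  with Q(2) R(2) show ?thesis
    unfolding has_interval_partition_def by blast
qed

definition joins :: "'a set set \<Rightarrow> 'a set set \<Rightarrow> 'a set set" where
  "joins F G = {T \<union> U | T U. T \<in> F \<and> U \<in> G}"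

lemma joinsI: "T = U \<union> V \<Longrightarrow> U \<in> F \<Longrightarrow> V \<in> G \<Longrightarrow> T \<in> joins F G"
  unfolding joins_def by blast

lemma joins_intervals:
  assumes "A \<subseteq> C" "A' \<subseteq> C'"
  shows "joins {A..C} {A'..C'} = {A \<union> A'..C \<union> C'}"
proof
  show "joins {A..C} {A'..C'} \<subseteq> {A \<union> A'..C \<union> C'}"
    by (auto simp: joins_def)
  show "{A \<union> A'..C \<union> C'} \<subseteq> joins {A..C} {A'..C'}"
  proof
    fix T assume T: "T \<in> {A \<union> A'..C \<union> C'}"
    then have "T = (T \<inter> C) \<union> (T \<inter> C')" "T \<inter> C \<in> {A..C}" "T \<inter> C' \<in> {A'..C'}"
      using assms by auto
    then show "T \<in> joins {A..C} {A'..C'}" by (rule joinsI)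
  qed
qed

text \<open>Since \<open>X\<close> and \<open>Y\<close> are disjoint, a member of a join determines
  its factors as its traces on \<open>X\<close> and \<open>Y\<close> (\<open>recover\<close>). Hence
  joins of different pairs of parts are disjoint.\<close>

lemma has_interval_partition_joins:
  assumes "has_interval_partition d F" "has_interval_partition e G"
    and FX: "\<Union>F \<subseteq> X" and GY: "\<Union>G \<subseteq> Y" and XY: "X \<inter> Y = {}"
  shows "has_interval_partition (d + e) (joins F G)"
proof -
  obtain Q where Q: "partition_on F Q" "\<forall>P\<in>Q. \<exists>A C. P = {A..C} \<and> finite C \<and> d \<le> card C"
    using assms(1) unfolding has_interval_partition_def by blast
  obtain R where R: "partition_on G R" "\<forall>P\<in>R. \<exists>A C. P = {A..C} \<and> finite C \<and> e \<le> card C"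
    using assms(2) unfolding has_interval_partition_def by blast
  define QR where "QR = (\<lambda>(P, P'). joins P P') ` (Q \<times> R)"
  have QF: "\<Union>Q = F" "{} \<notin> Q" and RG: "\<Union>R = G" "{} \<notin> R"
    using Q(1) R(1) by (auto simp: partition_on_def)
  have recover: "T \<inter> X \<in> P" "T \<inter> Y \<in> P'" if "T \<in> joins P P'" "P \<in> Q" "P' \<in> R" for T P P'
  proof -
    obtain U V where UV: "T = U \<union> V" "U \<in> P" "V \<in> P'"
      using \<open>T \<in> joins P P'\<close> unfolding joins_def by blast
    then have "U \<subseteq> X" "V \<subseteq> Y"
      using that QF RG FX GY by blast+
    then have "T \<inter> X = U" "T \<inter> Y = V"
      using UV(1) XY by blast+
    then show "T \<inter> X \<in> P" "T \<inter> Y \<in> P'" using UV by simp_all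
  qed
  have "partition_on (joins F G) QR"
  proof (rule partition_onI)
    show "\<Union>QR = joins F G"
      using QF(1) RG(1) unfolding QR_def joins_def by (auto; blast)
    have "joins P P' \<noteq> {}" if "P \<in> Q" "P' \<in> R" for P P'
    proof -
      have "P \<noteq> {}" "P' \<noteq> {}" using that QF(2) RG(2) by auto
      then obtain U V where "U \<in> P" "V \<in> P'" by blast
      then show ?thesis using joinsI[of "U \<union> V" U V P P'] by blast
    qed
    then show "{} \<notin> QR"
      unfolding QR_def by auto
    fix p q assume "p \<in> QR" "q \<in> QR" "p \<noteq> q"
    then obtain P P' S S' where *: "p = joins P P'" "q = joins S S'" "P \<in> Q" "P' \<in> R" "S \<in> Q" "S' \<in> R"
      unfolding QR_def by auto
    show "disjnt p q"
    proof (rule ccontr)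
      assume "\<not> disjnt p q"
      then obtain T where "T \<in> p" "T \<in> q" unfolding disjnt_def by blast
      then have "T \<inter> X \<in> P" "T \<inter> Y \<in> P'" "T \<inter> X \<in> S" "T \<inter> Y \<in> S'"
        using * recover by blast+
      then have "P = S" "P' = S'"
        using * partition_on_part_unique[OF Q(1)] partition_on_part_unique[OF R(1)] by simp_all
      with \<open>p \<noteq> q\<close> * show False by simp
    qed
  qed
  moreover have "\<exists>A C. p = {A..C} \<and> finite C \<and> d + e \<le> card C" if "p \<in> QR" for p
  proof -
    from that obtain P P' where *: "p = joins P P'" "P \<in> Q" "P' \<in> R"
      unfolding QR_def by auto
    obtain A C where AC: "P = {A..C}" "finite C" "d \<le> card C" using Q(2) * by blast
    obtain A' C' where AC': "P' = {A'..C'}" "finite C'" "e \<le> card C'" using R(2) * by blast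
    have "P \<noteq> {}" "P' \<noteq> {}" using QF(2) RG(2) * by auto
    then have sub: "A \<subseteq> C" "A' \<subseteq> C'" using AC(1) AC'(1) by auto
    \<comment> \<open>A top is a member of its own part, so \<open>C\<close> and \<open>C'\<close>
      lie in the disjoint ground sets and their sizes add up.\<close>
    have "C \<in> F" "C' \<in> G" using QF RG * AC(1) AC'(1) sub by auto
    then have "C \<inter> C' = {}" using FX GY XY by blast
    then have "card (C \<union> C') = card C + card C'" using AC AC' by (simp add: card_Un_disjoint)
    then show ?thesis
      using * AC AC' sub joins_intervals[OF sub] by (intro exI[of _ "A \<union> A'"] exI[of _ "C \<union> C'"]) auto
  qed
  ultimately show ?thesis unfolding has_interval_partition_def by blast
qed

section \<open>Tilings of words by 1, 00 and 01\<close>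

text \<open>Whether the word that \<open>T\<close> spells along a list, letter \<open>1\<close> for the elements of \<open>T\<close>, can be
  cut into the tiles \<open>1\<close>, \<open>00\<close> and \<open>01\<close>; the flag records a tile begun by \<open>0\<close> and still
  waiting for its second letter.\<close>

fun parses :: "'a set \<Rightarrow> bool \<Rightarrow> 'a list \<Rightarrow> bool" where
  "parses T pending [] \<longleftrightarrow> \<not> pending"
| "parses T True (x # xs) \<longleftrightarrow> parses T False xs"
| "parses T False (x # xs) \<longleftrightarrow> parses T (x \<notin> T) xs"

text \<open>A final 1 is accepted in both states, as the tile 1 or as the end of 01. A final 0 is
  accepted exactly when a tile is open before it.\<close>

lemma parses_snoc: "parses T b (xs @ [z]) \<longleftrightarrow> z \<in> T \<or> \<not> parses T b xs"
proof (induction xs arbitrary: b)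
  case Nil
  show ?case by (cases b) auto
next
  case (Cons x xs)
  then show ?case by (cases b) auto
qed

text \<open>A letter 0 exchanges the states of the two runs, a letter 1 leaves nothing pending in
  either; so they agree after the first 1.\<close>

lemma parses_forget: "T \<inter> set xs \<noteq> {} \<Longrightarrow> parses T True xs = parses T False xs"
proof (induction xs)
  case (Cons x xs)
  then show ?case by (cases "x \<in> T") auto
qed simp

lemma parses_no_letter: "T \<inter> set xs = {} \<Longrightarrow> parses T b xs \<longleftrightarrow> b = odd (length xs)"
  by (induction T b xs rule: parses.induct) auto

lemma parses_insert: "x \<notin> set xs \<Longrightarrow> parses (insert x T) b xs = parses T b xs"
  by (induction T b xs rule: parses.induct) auto

text \<open>Induction along the first tile. The tile 1 at \<open>x\<close> gives the factor
  \<open>{{x}..{x}}\<close>; a tile 00 or 01 on \<open>x\<close>, \<open>y\<close> leaves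
  \<open>y\<close> free and gives \<open>{{}..{y}}\<close>. Each tile puts one element into the top
  and covers at most two letters, whence the bound.\<close>

lemma has_interval_partition_parses:
  "distinct xs \<Longrightarrow> has_interval_partition ((length xs + 1) div 2) {T. T \<subseteq> set xs \<and> parses T False xs}"
proof (induction xs rule: length_induct)
  case (1 xs)
  consider "xs = []" | x where "xs = [x]" | x y ys where "xs = x # y # ys"
    by (metis neq_Nil_conv)
  then show ?case
  proof cases
    case 1
    have "{T. T \<subseteq> set xs \<and> parses T False xs} = {{}..{}}" using 1 by auto
    then show ?thesis using 1 has_interval_partition_interval[of "{}" "{}" 0] by simp
  next
    case (2 x)
    \<comment> \<open>A single letter 0 would leave its tile open.\<close>
    have "{T. T \<subseteq> set xs \<and> parses T False xs} = {{x}..{x}}" using 2 by auto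
    then show ?thesis using 2 has_interval_partition_interval[of "{x}" "{x}" 1] by simp
  next
    case (3 x y ys)
    let ?P = "\<lambda>xs. {T. T \<subseteq> set xs \<and> parses T False xs}"
    have dist: "distinct (x # y # ys)" using 1 3 by simp
    have P1: "has_interval_partition ((length ys + 2) div 2) (?P (y # ys))"
      and P2: "has_interval_partition ((length ys + 1) div 2) (?P ys)"
      using "1.IH"[rule_format, of "y # ys"] "1.IH"[rule_format, of ys] 3 dist by simp_all
    have "has_interval_partition (1 + (length ys + 2) div 2) (joins {{x}..{x}} (?P (y # ys)))"
      using dist by (intro has_interval_partition_joins[OF _ P1, where X = "{x}" and Y = "set (y # ys)"]
        has_interval_partition_interval) auto
    then have "has_interval_partition ((length xs + 1) div 2) (joins {{x}..{x}} (?P (y # ys)))"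
      by (rule has_interval_partition_mono) (use 3 in simp)
    moreover have "has_interval_partition (1 + (length ys + 1) div 2) (joins {{}..{y}} (?P ys))"
      using dist by (intro has_interval_partition_joins[OF _ P2, where X = "{y}" and Y = "set ys"]
        has_interval_partition_interval) auto
    then have "has_interval_partition ((length xs + 1) div 2) (joins {{}..{y}} (?P ys))"
      by (rule has_interval_partition_mono) (use 3 in simp)
    moreover have "joins {{x}..{x}} (?P (y # ys)) = {T \<in> ?P xs. x \<in> T}"
    proof (intro Set.set_eqI iffI)
      fix T assume "T \<in> joins {{x}..{x}} (?P (y # ys))"
      then show "T \<in> {T \<in> ?P xs. x \<in> T}"
        using 3 dist by (auto simp: joins_def parses_insert)
    next
      fix T assume T: "T \<in> {T \<in> ?P xs. x \<in> T}"
      then have "T = {x} \<union> (T - {x})" "{x} \<in> {{x}..{x}}" by auto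
      moreover have "T - {x} \<in> ?P (y # ys)"
        using T 3 dist parses_insert[of x "y # ys" "T - {x}" False] by (auto simp: insert_absorb)
      ultimately show "T \<in> joins {{x}..{x}} (?P (y # ys))" by (rule joinsI)
    qed
    moreover have "joins {{}..{y}} (?P ys) = {T \<in> ?P xs. x \<notin> T}"
    proof (intro Set.set_eqI iffI)
      fix T assume "T \<in> joins {{}..{y}} (?P ys)"
      then show "T \<in> {T \<in> ?P xs. x \<notin> T}"
        using 3 dist by (auto simp: joins_def parses_insert subset_singleton_iff)
    next
      fix T assume T: "T \<in> {T \<in> ?P xs. x \<notin> T}"
      then have "T = (T \<inter> {y}) \<union> (T - {y})" "T \<inter> {y} \<in> {{}..{y}}" by auto
      moreover have "T - {y} \<in> ?P ys"
        using T 3 dist parses_insert[of y ys "T - {y}" False] by (cases "y \<in> T") (auto simp: insert_absorb)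
      ultimately show "T \<in> joins {{}..{y}} (?P ys)" by (rule joinsI)
    qed
    ultimately have "has_interval_partition ((length xs + 1) div 2)
        ({T \<in> ?P xs. x \<in> T} \<union> {T \<in> ?P xs. x \<notin> T})"
      by (intro has_interval_partition_Un) (simp only:, simp only:, blast)
    moreover have "?P xs = {T \<in> ?P xs. x \<in> T} \<union> {T \<in> ?P xs. x \<notin> T}" by auto
    ultimately show ?thesis by (simp only:)
  qed
qed

text \<open>Read cyclically, a word \<open>w = x v z\<close> that is not all \<open>0\<close> has exactly one tiling: either \<open>w\<close> is
  parsed, or \<open>z = 0\<close> is paired with \<open>x\<close> and \<open>v\<close> is parsed. The parse from the wrong start
  merges with the right one at the first \<open>1\<close>. Odd length excludes a tiling of the zero word.\<close>

lemma nonempty_subsets_odd: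
  assumes "finite X" "odd (card X)"
  shows "has_interval_partition ((card X + 1) div 2) {T. T \<subseteq> X \<and> T \<noteq> {}}"
proof -
  obtain xs where xs: "set xs = X" "distinct xs" "length xs = card X"
    using assms(1) finite_distinct_list distinct_card by metis
  show ?thesis
  proof (cases "length xs = 1")
    case True
    then obtain x where "X = {x}" using xs by (auto simp: length_Suc_conv)
    then have "{T. T \<subseteq> X \<and> T \<noteq> {}} = {{x}..{x}}" by auto
    then show ?thesis using \<open>X = {x}\<close> has_interval_partition_interval[of "{x}" "{x}" 1] by simp
  next
    case False
    obtain x ys where "xs = x # ys" using xs assms(2) by (cases xs) auto
    moreover from this obtain vs z where "ys = vs @ [z]" using False by (cases ys rule: rev_cases) auto
    ultimately have w: "xs = x # vs @ [z]" by simp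
    let ?P = "\<lambda>xs. {T. T \<subseteq> set xs \<and> parses T False xs}"
    \<comment> \<open>Here the tile that starts with the 0 at \<open>z\<close> wraps around to
      \<open>x\<close>, whose letter is therefore free.\<close>
    let ?W = "joins {{}..{x}} (?P vs)"
    have odd: "odd (length vs)" using assms(2) xs(3)[symmetric] w by simp
    have W: "T \<in> ?W \<longleftrightarrow> T \<subseteq> X \<and> z \<notin> T \<and> parses T False vs" for T
    proof
      assume "T \<in> ?W"
      then show "T \<subseteq> X \<and> z \<notin> T \<and> parses T False vs"
        using xs w by (auto simp: joins_def parses_insert subset_singleton_iff)
    next
      assume T: "T \<subseteq> X \<and> z \<notin> T \<and> parses T False vs"
      then have "T = (T \<inter> {x}) \<union> (T - {x})" "T \<inter> {x} \<in> {{}..{x}}" by auto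
      moreover have "T - {x} \<in> ?P vs"
        using T w xs parses_insert[of x vs "T - {x}" False] by (cases "x \<in> T") (auto simp: insert_absorb)
      ultimately show "T \<in> ?W" by (rule joinsI)
    qed
    \<comment> \<open>If all letters on \<open>vs\<close> are 0, then
      \<open>parses T False vs\<close> fails by odd length, and the left side holds because
      \<open>T\<close> contains \<open>x\<close> or \<open>z\<close>. Otherwise the letter at
      \<open>x\<close> is forgotten at the first 1 in \<open>vs\<close>.\<close>
    have key: "parses T False xs \<longleftrightarrow> z \<in> T \<or> \<not> parses T False vs" if "T \<subseteq> X" "T \<noteq> {}" for T
    proof (cases "T \<inter> set vs = {}")
      case True
      then show ?thesis using that w xs odd by (auto simp: parses_snoc parses_no_letter)
    next
      case False
      then show ?thesis using w by (cases "x \<in> T") (simp_all add: parses_snoc parses_forget)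
    qed
    \<comment> \<open>Zero words of odd length are not parsed, so the empty set is neither in
      \<open>?P xs\<close> nor in \<open>?W\<close>.\<close>
    have empty: "\<not> parses {} False xs" "\<not> parses {} False vs"
      using odd w by (auto simp: parses_no_letter simp del: parses.simps)
    have "{T. T \<subseteq> X \<and> T \<noteq> {}} = ?P xs \<union> ?W"
      by (intro Set.set_eqI) (use key empty xs(1) in \<open>simp add: W del: parses.simps; metis\<close>)
    moreover have "?P xs \<inter> ?W = {}"
    proof (rule ccontr)
      assume "?P xs \<inter> ?W \<noteq> {}"
      then obtain T where "T \<in> ?P xs" "T \<in> ?W" by blast
      then show False using key[of T] empty xs(1) W[of T] by (cases "T = {}") (simp_all del: parses.simps)
    qed
    moreover have "has_interval_partition ((card X + 1) div 2) (?P xs)"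
      using has_interval_partition_parses[OF xs(2)] xs(3) by simp
    moreover have "has_interval_partition ((card X + 1) div 2) ?W"
    proof (rule has_interval_partition_mono)
      show "has_interval_partition (1 + (length vs + 1) div 2) ?W"
        using xs w by (intro has_interval_partition_joins[where X = "{x}" and Y = "set vs"]
            has_interval_partition_parses has_interval_partition_interval) auto
    qed (use xs(3) w in simp)
    ultimately show ?thesis by (simp only: has_interval_partition_Un)
  qed
qed

lemma nonempty_subsets_interval_partition:
  assumes "finite X" "X \<noteq> {}"
  shows "has_interval_partition ((card X + 1) div 2) {T. T \<subseteq> X \<and> T \<noteq> {}}"
proof (cases "odd (card X)")
  case True
  then show ?thesis using nonempty_subsets_odd assms by blast
next
  case False
  obtain x where "x \<in> X" using assms by blast
  let ?Y = "X - {x}"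
  have card: "card X = card ?Y + 1" using card.remove[OF assms(1) \<open>x \<in> X\<close>] by simp
  then have "has_interval_partition ((card ?Y + 1) div 2) {T. T \<subseteq> ?Y \<and> T \<noteq> {}}"
    using nonempty_subsets_odd[of ?Y] assms False by simp
  \<comment> \<open>Half of \<open>card X\<close> equals half of the odd number
    \<open>card ?Y\<close> rounded up, so dropping \<open>x\<close> costs nothing.\<close>
  moreover have "(card X + 1) div 2 = (card ?Y + 1) div 2" using card False by presburger
  moreover have "has_interval_partition ((card X + 1) div 2) {{x}..X}"
    using assms \<open>x \<in> X\<close> by (intro has_interval_partition_interval) auto
  moreover have "{T. T \<subseteq> X \<and> T \<noteq> {}} = {{x}..X} \<union> {T. T \<subseteq> ?Y \<and> T \<noteq> {}}"
    using \<open>x \<in> X\<close> by auto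
  moreover have "{{x}..X} \<inter> {T. T \<subseteq> ?Y \<and> T \<noteq> {}} = {}" by auto
  ultimately show ?thesis by (simp only: has_interval_partition_Un)
qed

section \<open>Sets that meet every block\<close>

definition meeting_all :: "('i \<Rightarrow> 'a set) \<Rightarrow> 'i set \<Rightarrow> 'a set set" where
  "meeting_all B J = {T. T \<subseteq> \<Union>(B ` J) \<and> (\<forall>i\<in>J. T \<inter> B i \<noteq> {})}"

lemma meeting_all_insert:
  assumes "disjoint_family_on B (insert k J)" "k \<notin> J"
  shows "meeting_all B (insert k J) = joins {T. T \<subseteq> B k \<and> T \<noteq> {}} (meeting_all B J)"
proof -
  have disj: "B k \<inter> \<Union>(B ` J) = {}"
    using assms unfolding disjoint_family_on_def by fastforce
  show ?thesis
  proof (intro Set.set_eqI iffI)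
    fix T assume T: "T \<in> meeting_all B (insert k J)"
    have "T = (T \<inter> B k) \<union> (T \<inter> \<Union>(B ` J))" "T \<inter> B k \<in> {T. T \<subseteq> B k \<and> T \<noteq> {}}"
      using T by (auto simp: meeting_all_def)
    moreover have "T \<inter> \<Union>(B ` J) \<inter> B i = T \<inter> B i" if "i \<in> J" for i
      using that by blast
    then have "T \<inter> \<Union>(B ` J) \<in> meeting_all B J"
      using T by (simp add: meeting_all_def)
    ultimately show "T \<in> joins {T. T \<subseteq> B k \<and> T \<noteq> {}} (meeting_all B J)"
      by (rule joinsI)
  next
    fix T assume "T \<in> joins {T. T \<subseteq> B k \<and> T \<noteq> {}} (meeting_all B J)"
    then show "T \<in> meeting_all B (insert k J)"
      unfolding joins_def meeting_all_def by blast
  qed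
qed

text \<open>Blocks are joined one at a time over disjoint ground sets, starting from the family
  \<open>{{}}\<close> that belongs to no blocks.\<close>

lemma has_interval_partition_meeting_all:
  assumes "finite J" "disjoint_family_on B J" "\<And>i. i \<in> J \<Longrightarrow> finite (B i) \<and> B i \<noteq> {}"
  shows "has_interval_partition (\<Sum>i\<in>J. (card (B i) + 1) div 2) (meeting_all B J)"
  using assms
proof (induction J)
  case empty
  have "meeting_all B {} = {{}..{}}" by (auto simp: meeting_all_def)
  then show ?case using has_interval_partition_interval[of "{}" "{}" 0] by simp
next
  case (insert k J)
  have IH: "has_interval_partition (\<Sum>i\<in>J. (card (B i) + 1) div 2) (meeting_all B J)"
    using insert by (auto intro!: insert.IH disjoint_family_on_mono[of J "insert k J"])
  have "B k \<inter> \<Union>(B ` J) = {}"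
    using insert unfolding disjoint_family_on_def by fastforce
  then have "has_interval_partition ((card (B k) + 1) div 2 + (\<Sum>i\<in>J. (card (B i) + 1) div 2))
      (joins {T. T \<subseteq> B k \<and> T \<noteq> {}} (meeting_all B J))"
    using insert.prems IH
    by (intro has_interval_partition_joins[where X = "B k" and Y = "\<Union>(B ` J)"]
        nonempty_subsets_interval_partition) (auto simp: meeting_all_def)
  then show ?case using meeting_all_insert[of B k J] insert by simp
qed

section \<open>Hilbert depth\<close>

text \<open>The expression of \<open>beta\<close> for arbitrary level sizes \<open>f\<close>. It is
  linear in \<open>f\<close>, so it can be summed over the parts of a partition.\<close>

definition beta_of :: "(nat \<Rightarrow> nat) \<Rightarrow> nat \<Rightarrow> nat \<Rightarrow> int" where
  "beta_of f d k = (\<Sum>j=0..k. (- 1) ^ (k - j) * int ((d - j) choose (k - j)) * int (f j))"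

text \<open>This is the coefficient for the full Boolean lattice on \<open>c\<close> points.
  Pascal's rule reduces \<open>(Suc c, D, q)\<close> to the cases \<open>(c, D, q)\<close> and
  \<open>(c, D - 1, q - 1)\<close>; when \<open>D\<close> equals the number of points, the sum
  collapses to \<open>(D choose q) * (1 - 1)^q\<close>.\<close>

lemma alternating_binomial_sum_nonneg:
  assumes "q \<le> D" "D \<le> c"
  shows "0 \<le> (\<Sum>l=0..q. (- 1) ^ (q - l) * int ((D - l) choose (q - l)) * int (c choose l))"
  using assms
proof (induction c arbitrary: D q)
  case 0
  then show ?case by simp
next
  case (Suc c)
  show ?case
  proof (cases "D = Suc c")
    case True
    have "(\<Sum>l=0..q. (- 1) ^ (q - l) * int ((D - l) choose (q - l)) * int (Suc c choose l))
        = (\<Sum>l=0..q. int (D choose q) * (int (q choose l) * 1 ^ l * (- 1) ^ (q - l)))"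
    proof (rule sum.cong)
      fix l assume "l \<in> {0..q}"
      then have "int (D choose q) * int (q choose l) = int (D choose l) * int ((D - l) choose (q - l))"
        using choose_mult[of l q D] Suc.prems(1) by (simp flip: of_nat_mult)
      then show "(- 1) ^ (q - l) * int ((D - l) choose (q - l)) * int (Suc c choose l)
          = int (D choose q) * (int (q choose l) * 1 ^ l * (- 1) ^ (q - l))"
        using True by (simp add: algebra_simps)
    qed simp
    also have "\<dots> = int (D choose q) * (1 + - 1) ^ q"
      unfolding binomial_ring sum_distrib_left by (simp add: atLeast0AtMost)
    finally show ?thesis by simp
  next
    case False
    then have D: "q \<le> D" "D \<le> c" using Suc.prems by auto
    show ?thesis
    proof (cases q)
      case 0
      then show ?thesis by simp
    next
      case (Suc p)
      \<comment> \<open>The term \<open>l = 0\<close> is split off so that Pascal's rule applies to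
        \<open>Suc c choose Suc l\<close>; the two halves then reassemble into the sums for
        \<open>D\<close> and for \<open>D - 1\<close>.\<close>
      have "(\<Sum>l=0..q. (- 1) ^ (q - l) * int ((D - l) choose (q - l)) * int (Suc c choose l))
        = (- 1) ^ q * int (D choose q) * 1 + (\<Sum>l=0..p. (- 1) ^ (p - l) *
             int ((D - Suc l) choose (p - l)) * (int (c choose l) + int (c choose Suc l)))"
        unfolding Suc sum.atLeast0_atMost_Suc_shift by (simp add: comp_def)
      also have "\<dots> = (\<Sum>l=0..q. (- 1) ^ (q - l) * int ((D - l) choose (q - l)) * int (c choose l))
        + (\<Sum>l=0..p. (- 1) ^ (p - l) * int ((D - 1 - l) choose (p - l)) * int (c choose l))"
        unfolding Suc sum.atLeast0_atMost_Suc_shift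
        by (simp add: comp_def algebra_simps sum.distrib)
      also have "\<dots> \<ge> 0"
        using Suc.IH[of q D] Suc.IH[of p "D - 1"] D Suc by simp
      finally show ?thesis .
    qed
  qed
qed

text \<open>The function lists the level sizes of an interval from size \<open>a\<close> to size
  \<open>c\<close>, a Boolean lattice of rank \<open>c - a\<close> shifted by \<open>a\<close>.
  Substituting \<open>l = j - a\<close> gives the lattice case with \<open>d - a\<close> and
  \<open>k - a\<close>; for \<open>k < a\<close> every term vanishes.\<close>

lemma beta_of_binomial_nonneg:
  assumes "k \<le> d" "d \<le> c"
  shows "0 \<le> beta_of (\<lambda>j. if a \<le> j then (c - a) choose (j - a) else 0) d k"
proof (cases "a \<le> k")
  case True
  have "beta_of (\<lambda>j. if a \<le> j then (c - a) choose (j - a) else 0) d k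
      = (\<Sum>j=a..k. (- 1) ^ (k - j) * int ((d - j) choose (k - j)) * int ((c - a) choose (j - a)))"
    unfolding beta_of_def by (rule sum.mono_neutral_cong_right) auto
  also have "\<dots> = (\<Sum>l=0..k-a. (- 1) ^ (k - a - l) * int ((d - a - l) choose (k - a - l)) * int ((c - a) choose l))"
    using True by (intro sum.reindex_bij_witness[of _ "\<lambda>l. l + a" "\<lambda>j. j - a"]) auto
  also have "\<dots> \<ge> 0"
    using assms by (intro alternating_binomial_sum_nonneg) auto
  finally show ?thesis .
next
  case False
  then have "beta_of (\<lambda>j. if a \<le> j then (c - a) choose (j - a) else 0) d k = 0"
    unfolding beta_of_def by (intro sum.neutral) auto
  then show ?thesis by simp
qed

lemma card_interval_level:
  assumes "A \<subseteq> C" "finite C"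
  shows "card {T \<in> {A..C}. card T = j} = (if card A \<le> j then (card C - card A) choose (j - card A) else 0)"
proof (cases "card A \<le> j")
  case True
  have finA: "finite A" using assms finite_subset by blast
  have "bij_betw (\<lambda>T. T - A) {T \<in> {A..C}. card T = j} {U. U \<subseteq> C - A \<and> card U = j - card A}"
  proof (rule bij_betw_byWitness[where f' = "\<lambda>U. U \<union> A"])
    show "\<forall>U\<in>{U. U \<subseteq> C - A \<and> card U = j - card A}. U \<union> A - A = U" by auto
    show "(\<lambda>T. T - A) ` {T \<in> {A..C}. card T = j} \<subseteq> {U. U \<subseteq> C - A \<and> card U = j - card A}"
      using finA by (auto simp: card_Diff_subset)
    show "(\<lambda>U. U \<union> A) ` {U. U \<subseteq> C - A \<and> card U = j - card A} \<subseteq> {T \<in> {A..C}. card T = j}"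
    proof clarify
      fix U assume U: "U \<subseteq> C - A" "card U = j - card A"
      then have "finite U" "U \<inter> A = {}" using assms(2) by (auto intro: finite_subset)
      then show "U \<union> A \<in> {A..C} \<and> card (U \<union> A) = j"
        using U True finA assms(1) by (auto simp: card_Un_disjoint)
    qed
  qed auto
  then have "card {T \<in> {A..C}. card T = j} = card {U. U \<subseteq> C - A \<and> card U = j - card A}"
    by (rule bij_betw_same_card)
  also have "\<dots> = (card C - card A) choose (j - card A)"
    using n_subsets[of "C - A"] assms finA by (simp add: card_Diff_subset)
  finally show ?thesis using True by simp
next
  case False
  have "card A \<le> card T" if "T \<in> {A..C}" for T
    using that assms(2) by (auto intro!: card_mono intro: finite_subset)
  then have "{T \<in> {A..C}. card T = j} = {}" using False by blast
  then show ?thesis using False by (simp only: card.empty if_False)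
qed

text \<open>Level sizes add up over the disjoint parts, hence so do the coefficients, and each part
  is an interval with a top of size at least \<open>d\<close>.\<close>

lemma beta_of_interval_partition_nonneg:
  assumes "has_interval_partition d F" "finite F" "k \<le> d"
  shows "0 \<le> beta_of (\<lambda>j. card {T \<in> F. card T = j}) d k"
proof -
  obtain Q where Q: "partition_on F Q" "\<forall>P\<in>Q. \<exists>A C. P = {A..C} \<and> finite C \<and> d \<le> card C"
    using assms(1) unfolding has_interval_partition_def by blast
  have QF: "\<Union>Q = F" "{} \<notin> Q" using Q(1) by (auto simp: partition_on_def)
  have finQ: "finite Q" "\<And>P. P \<in> Q \<Longrightarrow> finite P"
    using QF(1) assms(2) by (auto simp: finite_UnionD intro: finite_subset)
  have level: "card {T \<in> F. card T = j} = (\<Sum>P\<in>Q. card {T \<in> P. card T = j})" for j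
  proof -
    have "{T \<in> F. card T = j} = (\<Union>P\<in>Q. {T \<in> P. card T = j})" using QF(1) by blast
    moreover have "{T \<in> P. card T = j} \<inter> {T \<in> R. card T = j} = {}" if "P \<in> Q" "R \<in> Q" "P \<noteq> R" for P R
      using pairwiseD[OF partition_onD2[OF Q(1)] that] by (auto simp: disjnt_iff)
    ultimately show ?thesis
      using finQ by (simp add: card_UN_disjoint)
  qed
  have "beta_of (\<lambda>j. card {T \<in> F. card T = j}) d k = (\<Sum>P\<in>Q. beta_of (\<lambda>j. card {T \<in> P. card T = j}) d k)"
    unfolding beta_of_def level of_nat_sum sum_distrib_left by (rule sum.swap)
  also have "\<dots> \<ge> 0"
  proof (rule sum_nonneg)
    fix P assume "P \<in> Q"
    then obtain A C where P: "P = {A..C}" "finite C" "d \<le> card C" using Q(2) by blast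
    moreover have "P \<noteq> {}" using \<open>P \<in> Q\<close> QF(2) by blast
    ultimately have "A \<subseteq> C" by simp
    show "0 \<le> beta_of (\<lambda>j. card {T \<in> P. card T = j}) d k"
      unfolding P(1) card_interval_level[OF \<open>A \<subseteq> C\<close> P(2)]
      using beta_of_binomial_nonneg[OF assms(3) P(3), of "card A"] by simp
  qed
  finally show ?thesis .
qed

text \<open>At index \<open>r\<close> the coefficient is just \<open>f r\<close>, so this is the
  first one that can be negative, and the only one that the upper bound uses.\<close>

lemma beta_of_Suc_initial_zeros:
  assumes "\<And>j. j < r \<Longrightarrow> f j = 0"
  shows "beta_of f d (Suc r) = int (f (Suc r)) - int (d - r) * int (f r)"
proof -
  have "beta_of f d (Suc r)
      = (\<Sum>j\<in>{r, Suc r}. (- 1) ^ (Suc r - j) * int ((d - j) choose (Suc r - j)) * int (f j))"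
    unfolding beta_of_def using assms by (intro sum.mono_neutral_right) (auto simp: not_less_eq)
  then show ?thesis by simp
qed

section \<open>Upper bound from the two lowest levels\<close>

context
  fixes B :: "'i \<Rightarrow> 'a set" and J :: "'i set"
  assumes J: "finite J" and disj: "disjoint_family_on B J" and fin: "\<And>i. i \<in> J \<Longrightarrow> finite (B i)"
begin

lemma card_eq_sum_blocks:
  assumes "T \<subseteq> \<Union>(B ` J)"
  shows "card T = (\<Sum>i\<in>J. card (T \<inter> B i))"
proof -
  have "T = (\<Union>i\<in>J. T \<inter> B i)" using assms by blast
  then have "card T = card (\<Union>i\<in>J. T \<inter> B i)" by simp
  also have "\<dots> = (\<Sum>i\<in>J. card (T \<inter> B i))"
    using J disj fin by (intro card_UN_disjoint') (auto simp: disjoint_family_on_def)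
  finally show ?thesis .
qed

lemma card_meeting_all_ge:
  assumes "T \<in> meeting_all B J"
  shows "card J \<le> card T"
proof -
  have "1 \<le> card (T \<inter> B i)" if "i \<in> J" for i
    using that assms fin by (auto simp: meeting_all_def Suc_le_eq card_gt_0_iff)
  then have "card J \<le> (\<Sum>i\<in>J. card (T \<inter> B i))"
    using sum_mono[of J "\<lambda>_. 1::nat"] by fastforce
  then show ?thesis using assms card_eq_sum_blocks by (simp add: meeting_all_def)
qed

text \<open>One element is chosen from each block, and disjointness makes the choices distinct. This
  makes the lowest level positive, so that it can be cancelled.\<close>

lemma transversal_exists:
  assumes "\<And>i. i \<in> J \<Longrightarrow> B i \<noteq> {}"
  shows "\<exists>T\<in>meeting_all B J. card T = card J"
proof -
  have "\<forall>i\<in>J. \<exists>x. x \<in> B i" using assms by blast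
  then obtain f where f: "\<And>i. i \<in> J \<Longrightarrow> f i \<in> B i" using bchoice by metis
  have "inj_on f J"
    using f disj unfolding inj_on_def disjoint_family_on_def by (metis IntI empty_iff)
  then show ?thesis
    using f by (intro bexI[of _ "f ` J"]) (auto simp: card_image meeting_all_def)
qed

text \<open>A set of size \<open>r + 1\<close> meeting all \<open>r\<close> blocks has two elements in one of them, and stays
  in the family when either is removed.\<close>

lemma meeting_all_double_count:
  assumes N: "N = card (\<Union>(B ` J))"
  shows "2 * card {T \<in> meeting_all B J. card T = Suc (card J)}
    \<le> (N - card J) * card {T \<in> meeting_all B J. card T = card J}"
proof -
  define U where "U = \<Union>(B ` J)"
  define F where "F = meeting_all B J"
  define L where "L = (\<lambda>j. {T \<in> F. card T = j})"
  have finU: "finite U" using J fin by (simp add: U_def)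
  have FU: "T \<subseteq> U" if "T \<in> F" for T using that by (auto simp: F_def meeting_all_def U_def)
  have finF: "finite F" by (rule finite_subset[of _ "Pow U"]) (use FU finU in auto)
  define removable where "removable = (\<lambda>T. {x \<in> T. T - {x} \<in> F})"
  have two: "2 \<le> card (removable T)" if "T \<in> L (Suc (card J))" for T
  proof -
    have T: "T \<in> F" "card T = Suc (card J)" using that by (auto simp: L_def)
    have finT: "finite T" using FU[OF T(1)] finU finite_subset by blast
    \<comment> \<open>Pigeonhole: at most one element in every block would give
      \<open>card T \<le> card J\<close>.\<close>
    obtain k where k: "k \<in> J" "2 \<le> card (T \<inter> B k)"
    proof (rule ccontr)
      assume "\<not> thesis"
      then have "\<And>k. k \<in> J \<Longrightarrow> card (T \<inter> B k) \<le> 1" using that by fastforce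
      then have "(\<Sum>i\<in>J. card (T \<inter> B i)) \<le> card J"
        using sum_mono[of J "\<lambda>i. card (T \<inter> B i)" "\<lambda>_. 1"] by simp
      then show False
        using card_eq_sum_blocks[of T] FU[OF T(1)] T(2) by (simp add: U_def)
    qed
    have "T \<inter> B k \<subseteq> removable T"
    proof
      fix x assume x: "x \<in> T \<inter> B k"
      have "\<not> T \<inter> B k \<subseteq> {x}"
      proof
        assume "T \<inter> B k \<subseteq> {x}"
        then have "card (T \<inter> B k) \<le> card {x}" by (intro card_mono) auto
        then show False using k(2) by simp
      qed
      then have "(T - {x}) \<inter> B i \<noteq> {}" if "i \<in> J" for i
        using that x k(1) disj T(1) unfolding F_def meeting_all_def disjoint_family_on_def
        by (cases "i = k") blast+
      then show "x \<in> removable T"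
        using x T(1) by (auto simp: removable_def F_def meeting_all_def)
    qed
    then show ?thesis
      using k(2) card_mono[of "removable T" "T \<inter> B k"] finT by (simp add: removable_def)
  qed
  have fin_rem: "finite (removable T)" if "T \<in> F" for T
    using finite_subset[OF _ finU] FU[OF that] by (auto simp: removable_def)
  have finL: "finite (L j)" for j using finF by (simp add: L_def)
  \<comment> \<open>Double count of the pairs \<open>(T, x)\<close> with \<open>x\<close> removable.
    Sending such a pair to \<open>(T - {x}, x)\<close> is injective and lands among the pairs of a
    member of size \<open>card J\<close> and one of the \<open>N - card J\<close> points outside
    it.\<close>
  have "2 * card (L (Suc (card J))) \<le> (\<Sum>T\<in>L (Suc (card J)). card (removable T))"
    using sum_mono[of "L (Suc (card J))" "\<lambda>_. 2" "\<lambda>T. card (removable T)"] two by (simp add: mult.commute)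
  also have "\<dots> = card (Sigma (L (Suc (card J))) removable)"
    using finL fin_rem by (intro card_SigmaI[symmetric]) (auto simp: L_def)
  also have "\<dots> \<le> card (Sigma (L (card J)) (\<lambda>T. U - T))"
  proof (rule card_inj_on_le)
    show "inj_on (\<lambda>(T, x). (T - {x}, x)) (Sigma (L (Suc (card J))) removable)"
      by (auto simp: inj_on_def removable_def)
    show "(\<lambda>(T, x). (T - {x}, x)) ` Sigma (L (Suc (card J))) removable \<subseteq> Sigma (L (card J)) (\<lambda>T. U - T)"
      using FU by (auto simp: removable_def L_def)
    show "finite (Sigma (L (card J)) (\<lambda>T. U - T))" using finL finU by auto
  qed
  also have "\<dots> = (\<Sum>T\<in>L (card J). card (U - T))"
    using finL finU by (intro card_SigmaI) auto
  also have "\<dots> = (\<Sum>T\<in>L (card J). N - card J)"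
  proof (rule sum.cong)
    fix T assume "T \<in> L (card J)"
    then show "card (U - T) = N - card J"
      using FU[of T] finU N by (auto simp: L_def U_def card_Diff_subset finite_subset)
  qed simp
  finally show ?thesis by (simp add: L_def F_def mult.commute)
qed

lemma meeting_all_depth_bound:
  assumes nonempty: "\<And>i. i \<in> J \<Longrightarrow> B i \<noteq> {}" and N: "N = card (\<Union>(B ` J))"
    and nonneg: "\<forall>k\<le>d. 0 \<le> beta_of (\<lambda>j. card {T \<in> meeting_all B J. card T = j}) d k"
  shows "2 * d \<le> N + card J"
proof -
  let ?f = "\<lambda>j. card {T \<in> meeting_all B J. card T = j}"
  obtain T where T: "T \<in> meeting_all B J" "card T = card J" using transversal_exists[OF nonempty] by blast
  have finU: "finite (\<Union>(B ` J))" using J fin by simp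
  have "card J \<le> N"
    using T card_mono[OF finU, of T] N by (auto simp: meeting_all_def)
  \<comment> \<open>The index \<open>Suc (card J)\<close> is available in \<open>nonneg\<close> only
    if it is at most \<open>d\<close>. For smaller \<open>d\<close> the inequality
    \<open>card J \<le> N\<close>, given by the transversal, suffices.\<close>
  show ?thesis
  proof (cases "d \<le> card J")
    case True
    then show ?thesis using \<open>card J \<le> N\<close> by simp
  next
    case False
    have zero: "?f j = 0" if "j < card J" for j
    proof -
      have "{T \<in> meeting_all B J. card T = j} = {}"
        using that card_meeting_all_ge by (simp add: set_eq_iff) (metis not_le)
      then show ?thesis by (simp only: card.empty)
    qed
    have finF: "finite (meeting_all B J)"
      by (rule finite_subset[of _ "Pow (\<Union>(B ` J))"]) (use finU in \<open>auto simp: meeting_all_def\<close>)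
    have pos: "0 < ?f (card J)" using T finF by (auto simp: card_gt_0_iff)
    have "int (d - card J) * int (?f (card J)) \<le> int (?f (Suc (card J)))"
      using nonneg[rule_format, of "Suc (card J)"] False
      unfolding beta_of_Suc_initial_zeros[of "card J" ?f d, OF zero, simplified] by linarith
    then have "(d - card J) * ?f (card J) \<le> ?f (Suc (card J))"
      by (simp flip: of_nat_mult)
    then have "2 * (d - card J) * ?f (card J) \<le> (N - card J) * ?f (card J)"
      using meeting_all_double_count[OF N] by linarith
    then have "2 * (d - card J) \<le> N - card J" using pos by simp
    then show ?thesis using False \<open>card J \<le> N\<close> by linarith
  qed
qed

end

section \<open>Stanley decompositions\<close>

lemma poly_mapping_sum_single:
  "f = (\<Sum>a\<in>Poly_Mapping.keys f. Poly_Mapping.single a (Poly_Mapping.lookup f a))"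
  by (rule poly_mapping_eqI) (simp add: lookup_sum lookup_single when_def in_keys_iff)

lemma poly_mapping_monomial_induct:
  fixes f :: "'a \<Rightarrow>\<^sub>0 'b::comm_monoid_add"
  assumes "Poly_Mapping.keys f \<subseteq> E"
    and "V 0" and add: "\<And>g h. V g \<Longrightarrow> V h \<Longrightarrow> V (g + h)"
    and single: "\<And>a x. a \<in> E \<Longrightarrow> V (Poly_Mapping.single a x)"
  shows "V f"
proof -
  have "V (\<Sum>a\<in>S. Poly_Mapping.single a (Poly_Mapping.lookup f a))" if "finite S" "S \<subseteq> E" for S
    using that by (induction S) (auto intro: assms)
  then show ?thesis
    using assms(1) poly_mapping_sum_single[of f] by (metis finite_keys)
qed

text \<open>The \<open>K\<close>-span of the monomials with exponents in \<open>E\<close>; ideals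
  and Stanley spaces are both brought into this form.\<close>

definition monomial_subspace :: "(nat \<Rightarrow>\<^sub>0 nat) set \<Rightarrow> 'k::field mpoly set" where
  "monomial_subspace E = {f. Poly_Mapping.keys f \<subseteq> E}"

lemma monomial_subspaceD:
  "f \<in> monomial_subspace E \<Longrightarrow> a \<notin> E \<Longrightarrow> Poly_Mapping.lookup f a = 0"
  by (auto simp: monomial_subspace_def in_keys_iff)

lemma single_in_monomial_subspace [simp]:
  "Poly_Mapping.single a c \<in> monomial_subspace E \<longleftrightarrow> c = 0 \<or> a \<in> E"
  by (auto simp: monomial_subspace_def)

lemma zero_in_monomial_subspace [simp]: "0 \<in> monomial_subspace E"
  by (simp add: monomial_subspace_def)

lemma sum_in_monomial_subspace:
  assumes "\<And>d. d \<in> D \<Longrightarrow> g d \<in> monomial_subspace E"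
  shows "sum g D \<in> monomial_subspace E"
proof -
  have "Poly_Mapping.lookup (sum g D) a = 0" if "a \<notin> E" for a
    using assms that by (auto simp: lookup_sum dest: monomial_subspaceD intro!: sum.neutral)
  then show ?thesis
    by (auto simp: monomial_subspace_def in_keys_iff)
qed

text \<open>The coefficient of a sum at an exponent comes from the one summand whose exponent set
  contains it (\<open>only\<close>), so the summands can be read off. Conversely, cutting the
  support of \<open>f\<close> along the sets \<open>cn d\<close> gives a preimage.\<close>

lemma bij_betw_sum_monomial_subspaces:
  fixes E :: "(nat \<Rightarrow>\<^sub>0 nat) set" and cn :: "'d \<Rightarrow> (nat \<Rightarrow>\<^sub>0 nat) set"
  assumes "finite D" "disjoint_family_on cn D" "(\<Union>d\<in>D. cn d) = E"
  shows "bij_betw (\<lambda>g. \<Sum>d\<in>D. g d) (\<Pi>\<^sub>E d\<in>D. monomial_subspace (cn d))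
           (monomial_subspace E :: 'k::field mpoly set)"
proof -
  have only: "Poly_Mapping.lookup (\<Sum>d\<in>D. g d) e = Poly_Mapping.lookup (g d) e"
    if "g \<in> (\<Pi>\<^sub>E d\<in>D. monomial_subspace (cn d))" "d \<in> D" "e \<in> cn d" for g :: "'d \<Rightarrow> 'k mpoly" and d e
  proof -
    have "Poly_Mapping.lookup (\<Sum>d\<in>D. g d) e = (\<Sum>d'\<in>{d}. Poly_Mapping.lookup (g d') e)"
      unfolding lookup_sum
    proof (rule sum.mono_neutral_right)
      show "\<forall>i\<in>D - {d}. Poly_Mapping.lookup (g i) e = 0"
      proof
        fix i assume i: "i \<in> D - {d}"
        then have "e \<notin> cn i" using that assms(2) by (auto simp: disjoint_family_on_def)
        moreover have "g i \<in> monomial_subspace (cn i)" using that(1) i by auto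
        ultimately show "Poly_Mapping.lookup (g i) e = 0" using monomial_subspaceD by blast
      qed
    qed (use assms that in auto)
    then show ?thesis by simp
  qed
  show ?thesis
  proof (rule bij_betw_imageI)
    show "inj_on (\<lambda>g. \<Sum>d\<in>D. g d) (\<Pi>\<^sub>E d\<in>D. (monomial_subspace (cn d) :: 'k mpoly set))"
    proof (rule inj_onI)
      fix g h :: "'d \<Rightarrow> 'k mpoly"
      assume g: "g \<in> (\<Pi>\<^sub>E d\<in>D. monomial_subspace (cn d))" and h: "h \<in> (\<Pi>\<^sub>E d\<in>D. monomial_subspace (cn d))"
        and eq: "(\<Sum>d\<in>D. g d) = (\<Sum>d\<in>D. h d)"
      show "g = h"
      proof (rule PiE_ext[OF g h])
        fix d assume d: "d \<in> D"
        show "g d = h d"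
        proof (rule poly_mapping_eqI)
          fix e
          have "g d \<in> monomial_subspace (cn d)" "h d \<in> monomial_subspace (cn d)" using g h d by auto
          then show "Poly_Mapping.lookup (g d) e = Poly_Mapping.lookup (h d) e"
            using only[OF g d, of e] only[OF h d, of e] eq monomial_subspaceD[of "g d" "cn d" e] monomial_subspaceD[of "h d" "cn d" e]
            by (cases "e \<in> cn d") simp_all
        qed
      qed
    qed
    show "(\<lambda>g. \<Sum>d\<in>D. g d) ` (\<Pi>\<^sub>E d\<in>D. monomial_subspace (cn d)) = (monomial_subspace E :: 'k mpoly set)"
    proof
      show "(\<lambda>g. \<Sum>d\<in>D. g d) ` (\<Pi>\<^sub>E d\<in>D. monomial_subspace (cn d)) \<subseteq> (monomial_subspace E :: 'k mpoly set)"
      proof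
        fix f :: "'k mpoly" assume "f \<in> (\<lambda>g. \<Sum>d\<in>D. g d) ` (\<Pi>\<^sub>E d\<in>D. monomial_subspace (cn d))"
        then obtain g where g: "f = (\<Sum>d\<in>D. g d)" "g \<in> (\<Pi>\<^sub>E d\<in>D. monomial_subspace (cn d))" by blast
        have "g d \<in> monomial_subspace E" if "d \<in> D" for d
          using PiE_mem[OF g(2) that] that assms(3) by (auto simp: monomial_subspace_def)
        then show "f \<in> monomial_subspace E" unfolding g(1) by (rule sum_in_monomial_subspace)
      qed
      show "(monomial_subspace E :: 'k mpoly set) \<subseteq> (\<lambda>g. \<Sum>d\<in>D. g d) ` (\<Pi>\<^sub>E d\<in>D. monomial_subspace (cn d))"
      proof
        fix f :: "'k mpoly" assume f: "f \<in> monomial_subspace E"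
        define g where "g = (\<lambda>d\<in>D. \<Sum>a\<in>Poly_Mapping.keys f \<inter> cn d. Poly_Mapping.single a (Poly_Mapping.lookup f a))"
        have g: "g \<in> (\<Pi>\<^sub>E d\<in>D. monomial_subspace (cn d))"
          by (auto simp: g_def intro!: sum_in_monomial_subspace)
        have gE: "(\<Sum>d\<in>D. g d) \<in> monomial_subspace E"
        proof (rule sum_in_monomial_subspace)
          fix d assume "d \<in> D"
          then show "g d \<in> monomial_subspace E"
            using PiE_mem[OF g] assms(3) by (fastforce simp: monomial_subspace_def)
        qed
        have "f = (\<Sum>d\<in>D. g d)"
        proof (rule poly_mapping_eqI)
          fix e
          show "Poly_Mapping.lookup f e = Poly_Mapping.lookup (\<Sum>d\<in>D. g d) e"
          proof (cases "e \<in> E")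
            case True
            then obtain d where d: "d \<in> D" "e \<in> cn d" using assms(3) by blast
            then show ?thesis
              unfolding only[OF g d]
              by (simp add: g_def lookup_sum lookup_single when_def in_keys_iff)
          next
            case False
            then show ?thesis using monomial_subspaceD[OF f] monomial_subspaceD[OF gE] by simp
          qed
        qed
        then show "f \<in> (\<lambda>g. \<Sum>d\<in>D. g d) ` (\<Pi>\<^sub>E d\<in>D. monomial_subspace (cn d))" using g by blast
      qed
    qed
  qed
qed

text \<open>Both claims are tested on monomials. \<open>dlt e d\<close> has the monomial of exponent
  \<open>e\<close> in slot \<open>d\<close> and 0 elsewhere: an \<open>e\<close> in two sets would
  give two families with the same sum. A preimage of the monomial has a summand with nonzero
  coefficient at \<open>e\<close>, which gives the covering.\<close>

lemma bij_betw_sum_monomial_subspacesD: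
  fixes E :: "(nat \<Rightarrow>\<^sub>0 nat) set" and cn :: "'d \<Rightarrow> (nat \<Rightarrow>\<^sub>0 nat) set"
  assumes fin: "finite D"
    and bij: "bij_betw (\<lambda>g. \<Sum>d\<in>D. g d) (\<Pi>\<^sub>E d\<in>D. monomial_subspace (cn d))
           (monomial_subspace E :: 'k::field mpoly set)"
  shows "disjoint_family_on cn D" "(\<Union>d\<in>D. cn d) = E"
proof -
  define dlt where "dlt = (\<lambda>(e :: nat \<Rightarrow>\<^sub>0 nat) d. \<lambda>d'\<in>D. if d' = d then Poly_Mapping.single e (1::'k) else 0)"
  have dlt: "dlt e d \<in> (\<Pi>\<^sub>E d\<in>D. monomial_subspace (cn d))" if "d \<in> D" "e \<in> cn d" for e d
    using that by (auto simp: dlt_def)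
  have sum_dlt: "(\<Sum>d'\<in>D. dlt e d d') = Poly_Mapping.single e 1" if "d \<in> D" for e d
    using that fin by (simp add: dlt_def)
  show "disjoint_family_on cn D"
    unfolding disjoint_family_on_def
  proof (intro ballI impI, rule ccontr)
    fix d d' assume d: "d \<in> D" "d' \<in> D" "d \<noteq> d'" "cn d \<inter> cn d' \<noteq> {}"
    then obtain e where e: "e \<in> cn d" "e \<in> cn d'" by blast
    have "dlt e d = dlt e d'"
      using inj_onD[OF bij_betw_imp_inj_on[OF bij], of "dlt e d" "dlt e d'"] sum_dlt dlt d e by simp
    then have "dlt e d d = dlt e d' d" by simp
    then have "Poly_Mapping.lookup (dlt e d d) e = Poly_Mapping.lookup (dlt e d' d) e" by simp
    then show False using d by (simp add: dlt_def)
  qed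
  show "(\<Union>d\<in>D. cn d) = E"
  proof
    show "(\<Union>d\<in>D. cn d) \<subseteq> E"
    proof
      fix e assume "e \<in> (\<Union>d\<in>D. cn d)"
      then obtain d where "d \<in> D" "e \<in> cn d" by blast
      then have "Poly_Mapping.single e (1::'k) \<in> monomial_subspace E"
        using bij_betw_apply[OF bij dlt] sum_dlt by metis
      then show "e \<in> E" by simp
    qed
    show "E \<subseteq> (\<Union>d\<in>D. cn d)"
    proof
      fix e assume "e \<in> E"
      then have "Poly_Mapping.single e (1::'k) \<in> monomial_subspace E" by simp
      then obtain g where g: "g \<in> (\<Pi>\<^sub>E d\<in>D. monomial_subspace (cn d))"
        "Poly_Mapping.single e (1::'k) = (\<Sum>d\<in>D. g d)"
        using bij_betw_imp_surj_on[OF bij] by blast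
      have "(\<Sum>d\<in>D. Poly_Mapping.lookup (g d) e) \<noteq> 0"
        using arg_cong[OF g(2), of "\<lambda>f. Poly_Mapping.lookup f e"] by (simp add: lookup_sum)
      then obtain d where d: "d \<in> D" "Poly_Mapping.lookup (g d) e \<noteq> 0"
        by (meson sum.not_neutral_contains_not_neutral)
      then have "e \<in> cn d" using PiE_mem[OF g(1) d(1)] monomial_subspaceD by blast
      then show "e \<in> (\<Union>d\<in>D. cn d)" using d by blast
    qed
  qed
qed

section \<open>Cones of exponents and squarefree exponents\<close>

text \<open>The exponents of the monomials in \<open>x^a K[Z]\<close>.\<close>

definition cone :: "(nat \<Rightarrow>\<^sub>0 nat) \<Rightarrow> nat set \<Rightarrow> (nat \<Rightarrow>\<^sub>0 nat) set" where
  "cone a Z = {u + a | u. Poly_Mapping.keys u \<subseteq> Z}"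

lemma in_cone_iff:
  "e \<in> cone a Z \<longleftrightarrow> (\<forall>i. Poly_Mapping.lookup a i \<le> Poly_Mapping.lookup e i) \<and>
     (\<forall>i. i \<notin> Z \<longrightarrow> Poly_Mapping.lookup a i = Poly_Mapping.lookup e i)"
proof
  assume "e \<in> cone a Z"
  then obtain u where u: "e = u + a" "Poly_Mapping.keys u \<subseteq> Z" unfolding cone_def by blast
  then have "Poly_Mapping.lookup u i = 0" if "i \<notin> Z" for i
    using that by (auto simp: in_keys_iff)
  then show "(\<forall>i. Poly_Mapping.lookup a i \<le> Poly_Mapping.lookup e i) \<and>
     (\<forall>i. i \<notin> Z \<longrightarrow> Poly_Mapping.lookup a i = Poly_Mapping.lookup e i)"
    by (simp add: u lookup_add)
next
  assume *: "(\<forall>i. Poly_Mapping.lookup a i \<le> Poly_Mapping.lookup e i) \<and>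
     (\<forall>i. i \<notin> Z \<longrightarrow> Poly_Mapping.lookup a i = Poly_Mapping.lookup e i)"
  \<comment> \<open>Subtraction of exponents truncates at 0; it is exact here because
    \<open>a\<close> is coordinatewise below \<open>e\<close>.\<close>
  have "e = (e - a) + a"
    using * by (intro poly_mapping_eqI) (simp add: lookup_add minus_poly_mapping.rep_eq)
  moreover have "Poly_Mapping.keys (e - a) \<subseteq> Z"
  proof
    fix i assume "i \<in> Poly_Mapping.keys (e - a)"
    then have "Poly_Mapping.lookup e i - Poly_Mapping.lookup a i \<noteq> 0"
      by (simp add: in_keys_iff minus_poly_mapping.rep_eq)
    then show "i \<in> Z" using * by fastforce
  qed
  ultimately show "e \<in> cone a Z" unfolding cone_def by blast
qed

text \<open>Multiplication by \<open>c x^a\<close> shifts exponents by \<open>a\<close>. Conversely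
  \<open>c\<close> is invertible, so every monomial of the cone is reached after dividing its
  coefficient by \<open>c\<close>.\<close>

lemma stanley_space_single:
  fixes c :: "'k::field"
  assumes "c \<noteq> 0"
  shows "stanley_space (Poly_Mapping.single a c) Z = monomial_subspace (cone a Z)"
proof
  show "stanley_space (Poly_Mapping.single a c) Z \<subseteq> monomial_subspace (cone a Z)"
  proof
    fix f assume "f \<in> stanley_space (Poly_Mapping.single a c) Z"
    then obtain u where u: "f = u * Poly_Mapping.single a c" "u \<in> carrier (poly_ring Z)"
      unfolding stanley_space_def by blast
    have "Poly_Mapping.keys f \<subseteq> {b + d |b d. b \<in> Poly_Mapping.keys u \<and> d \<in> Poly_Mapping.keys (Poly_Mapping.single a c)}"
      unfolding u(1) by (rule keys_mult)
    then show "f \<in> monomial_subspace (cone a Z)"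
      using u(2) assms by (fastforce simp: monomial_subspace_def cone_def carrier_poly_ring)
  qed
  show "monomial_subspace (cone a Z) \<subseteq> stanley_space (Poly_Mapping.single a c) Z"
  proof
    fix f :: "'k mpoly" assume "f \<in> monomial_subspace (cone a Z)"
    then have "Poly_Mapping.keys f \<subseteq> cone a Z" by (simp add: monomial_subspace_def)
    then show "f \<in> stanley_space (Poly_Mapping.single a c) Z"
    proof (rule poly_mapping_monomial_induct)
      show "0 \<in> stanley_space (Poly_Mapping.single a c) Z"
        unfolding stanley_space_def by (auto intro!: exI[of _ 0] simp: carrier_poly_ring)
    next
      fix g h assume "g \<in> stanley_space (Poly_Mapping.single a c) Z" "h \<in> stanley_space (Poly_Mapping.single a c) Z"
      then obtain u v where "g = u * Poly_Mapping.single a c" "u \<in> carrier (poly_ring Z)"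
        "h = v * Poly_Mapping.single a c" "v \<in> carrier (poly_ring Z)"
        unfolding stanley_space_def by blast
      moreover from this have "u + v \<in> carrier (poly_ring Z)"
        using Poly_Mapping.keys_add[of u v] by (auto simp: carrier_poly_ring)
      ultimately show "g + h \<in> stanley_space (Poly_Mapping.single a c) Z"
        unfolding stanley_space_def by (auto simp: distrib_right intro!: exI[of _ "u + v"])
    next
      fix e and x :: 'k assume "e \<in> cone a Z"
      then obtain u where u: "e = u + a" "Poly_Mapping.keys u \<subseteq> Z" unfolding cone_def by blast
      then have "Poly_Mapping.single e x = Poly_Mapping.single u (x / c) * Poly_Mapping.single a c"
        using assms by (simp add: mult_single)
      moreover have "Poly_Mapping.single u (x / c) \<in> carrier (poly_ring Z)"
        using u(2) by (simp add: carrier_poly_ring)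
      ultimately show "Poly_Mapping.single e x \<in> stanley_space (Poly_Mapping.single a c) Z"
        unfolding stanley_space_def by blast
    qed
  qed
qed

text \<open>The exponent of a squarefree monomial. For infinite \<open>T\<close> the sum defaults to
  0, hence the finiteness assumptions below.\<close>

definition sqf :: "nat set \<Rightarrow> (nat \<Rightarrow>\<^sub>0 nat)" where
  "sqf T = (\<Sum>i\<in>T. Poly_Mapping.single i 1)"

lemma lookup_sqf: "finite T \<Longrightarrow> Poly_Mapping.lookup (sqf T) i = (if i \<in> T then 1 else 0)"
  by (simp add: sqf_def lookup_sum lookup_single when_def)

lemma keys_sqf [simp]: "finite T \<Longrightarrow> Poly_Mapping.keys (sqf T) = T"
  by (auto simp: in_keys_iff lookup_sqf split: if_splits)

text \<open>All coordinates of \<open>sqf T\<close> are at most 1, so \<open>a\<close> below it is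
  squarefree too, and the elements of \<open>T\<close> outside the support of \<open>a\<close> have
  to be free, that is, in \<open>Z\<close>.\<close>

lemma sqf_in_cone_iff:
  assumes "finite T"
  shows "sqf T \<in> cone a Z \<longleftrightarrow>
    a = sqf (Poly_Mapping.keys a) \<and> T \<in> {Poly_Mapping.keys a..Poly_Mapping.keys a \<union> Z}"
proof
  assume "sqf T \<in> cone a Z"
  then have le: "Poly_Mapping.lookup a i \<le> (if i \<in> T then 1 else 0)"
    and eq: "i \<notin> Z \<Longrightarrow> Poly_Mapping.lookup a i = (if i \<in> T then 1 else 0)" for i
    using assms by (simp_all add: in_cone_iff lookup_sqf)
  have "a = sqf (Poly_Mapping.keys a)"
  proof (rule poly_mapping_eqI)
    fix i show "Poly_Mapping.lookup a i = Poly_Mapping.lookup (sqf (Poly_Mapping.keys a)) i"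
      using le[of i] by (auto simp: lookup_sqf in_keys_iff split: if_splits)
  qed
  moreover have "Poly_Mapping.keys a \<subseteq> T"
  proof
    fix i assume "i \<in> Poly_Mapping.keys a"
    then show "i \<in> T" using le[of i] by (auto simp: in_keys_iff split: if_splits)
  qed
  moreover have "T \<subseteq> Poly_Mapping.keys a \<union> Z"
  proof
    fix i assume "i \<in> T"
    then show "i \<in> Poly_Mapping.keys a \<union> Z" using eq[of i] by (auto simp: in_keys_iff)
  qed
  ultimately show "a = sqf (Poly_Mapping.keys a) \<and> T \<in> {Poly_Mapping.keys a..Poly_Mapping.keys a \<union> Z}"
    by simp
next
  assume *: "a = sqf (Poly_Mapping.keys a) \<and> T \<in> {Poly_Mapping.keys a..Poly_Mapping.keys a \<union> Z}"
  then have "Poly_Mapping.lookup a i = (if i \<in> Poly_Mapping.keys a then 1 else 0)" for i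
    using lookup_sqf[OF finite_keys] by metis
  then show "sqf T \<in> cone a Z"
    using * assms unfolding in_cone_iff by (auto simp: lookup_sqf)
qed

text \<open>Because of \<open>A \<subseteq> C\<close>, coordinates in \<open>A\<close> may grow
  beyond 1, so only the support of \<open>e\<close> matters.\<close>

lemma in_cone_sqf_iff:
  assumes "A \<subseteq> C" "finite A"
  shows "e \<in> cone (sqf A) C \<longleftrightarrow> Poly_Mapping.keys e \<in> {A..C}"
proof
  assume "e \<in> cone (sqf A) C"
  then have le: "(if i \<in> A then 1 else 0) \<le> Poly_Mapping.lookup e i"
    and eq: "i \<notin> C \<Longrightarrow> (if i \<in> A then 1 else 0) = Poly_Mapping.lookup e i" for i
    using assms(2) by (simp_all add: in_cone_iff lookup_sqf)
  have "i \<in> Poly_Mapping.keys e" if "i \<in> A" for i using le[of i] that by (simp add: in_keys_iff)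
  moreover have "i \<in> C" if "i \<in> Poly_Mapping.keys e" for i
    by (rule ccontr) (use eq[of i] that assms(1) in \<open>auto simp: in_keys_iff split: if_splits\<close>)
  ultimately show "Poly_Mapping.keys e \<in> {A..C}" by auto
next
  assume "Poly_Mapping.keys e \<in> {A..C}"
  then have "\<And>i. i \<in> A \<Longrightarrow> Poly_Mapping.lookup e i \<noteq> 0" "\<And>i. i \<notin> C \<Longrightarrow> Poly_Mapping.lookup e i = 0"
    by (auto simp: in_keys_iff)
  then show "e \<in> cone (sqf A) C"
    using assms unfolding in_cone_iff by (auto simp: lookup_sqf Suc_le_eq)
qed

section \<open>Stanley decompositions and interval partitions\<close>

text \<open>A \<open>K\<close>-subspace for any \<open>F\<close>; the ideal of the theorem arises
  from the sets that meet all blocks.\<close>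

definition support_module :: "nat set set \<Rightarrow> 'k::field mpoly set" where
  "support_module F = monomial_subspace {e. Poly_Mapping.keys e \<in> F}"

lemma homogeneous_nonzero_single:
  assumes "homogeneous m" "m \<noteq> 0"
  obtains a c where "m = Poly_Mapping.single a c" "c \<noteq> 0"
proof -
  obtain a where "Poly_Mapping.keys m \<subseteq> {a}" using assms(1) unfolding homogeneous_def by blast
  then have "m = Poly_Mapping.single a (Poly_Mapping.lookup m a)"
    by (intro poly_mapping_eqI) (auto simp: lookup_single when_def in_keys_iff)
  moreover from this have "Poly_Mapping.lookup m a \<noteq> 0" using assms(2) by (metis single_zero)
  ultimately show ?thesis using that by blast
qed

lemma PiE_stanley_spaces_single:
  assumes "\<And>m Z. (m, Z) \<in> D \<Longrightarrow> m = Poly_Mapping.single (a m) (c m) \<and> c m \<noteq> 0"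
  shows "(\<Pi>\<^sub>E (m, Z)\<in>D. stanley_space m Z) = (\<Pi>\<^sub>E d\<in>D. monomial_subspace (case d of (m, Z) \<Rightarrow> cone (a m) Z))"
proof (rule PiE_cong)
  fix d assume "d \<in> D"
  moreover obtain m Z where "d = (m, Z)" by fastforce
  ultimately show "(case d of (m, Z) \<Rightarrow> stanley_space m Z)
      = monomial_subspace (case d of (m, Z) \<Rightarrow> cone (a m) Z)"
    using assms stanley_space_single by (metis (no_types, lifting) case_prod_conv)
qed

text \<open>The squarefree monomials in \<open>x\<^sup>a K[Z]\<close> form the interval from \<open>supp a\<close> to \<open>supp a \<union> Z\<close> if \<open>a\<close> is
  squarefree, and there are none otherwise.\<close>

lemma interval_partition_if_stanley_decomposition:
  fixes D :: "('k::field mpoly \<times> nat set) set"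
  assumes D: "stanley_decomposition p (support_module F) D" and F: "\<Union>F \<subseteq> {1..p}"
    and d: "\<And>m Z. (m, Z) \<in> D \<Longrightarrow> d \<le> card Z"
  shows "has_interval_partition d F"
proof -
  have fin: "finite D" and hom: "\<And>m Z. (m, Z) \<in> D \<Longrightarrow> homogeneous m \<and> Z \<subseteq> {1..p}"
    and free: "\<And>m Z u. (m, Z) \<in> D \<Longrightarrow> u \<in> carrier (poly_ring Z) \<Longrightarrow> u * m = 0 \<Longrightarrow> u = 0"
    and bij: "bij_betw (\<lambda>g. \<Sum>d\<in>D. g d) (\<Pi>\<^sub>E (m, Z)\<in>D. stanley_space m Z) (support_module F)"
    using D unfolding stanley_decomposition_def by blast+
  \<comment> \<open>Freeness applied to \<open>u = 1\<close>.\<close>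
  have "m \<noteq> 0" if "(m, Z) \<in> D" for m Z
    using free[OF that, of 1] by (auto simp: carrier_poly_ring)
  then have "\<exists>a c. m = Poly_Mapping.single a c \<and> c \<noteq> 0" if "(m, Z) \<in> D" for m Z
    using hom[OF that] that homogeneous_nonzero_single by metis
  then obtain a c where ac: "\<And>m Z. (m, Z) \<in> D \<Longrightarrow> m = Poly_Mapping.single (a m) (c m) \<and> c m \<noteq> 0"
    by metis
  define cn where "cn = (\<lambda>d. case d of (m, Z) \<Rightarrow> cone (a m :: nat \<Rightarrow>\<^sub>0 nat) Z)"
  have "(\<Pi>\<^sub>E (m, Z)\<in>D. stanley_space m Z) = (\<Pi>\<^sub>E d\<in>D. monomial_subspace (cn d))"
    unfolding cn_def by (rule PiE_stanley_spaces_single) (rule ac)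
  then have "bij_betw (\<lambda>g. \<Sum>d\<in>D. g d) (\<Pi>\<^sub>E d\<in>D. monomial_subspace (cn d)) (support_module F :: 'k mpoly set)"
    using bij by simp
  note cn = bij_betw_sum_monomial_subspacesD[OF fin this[unfolded support_module_def]]
  \<comment> \<open>Summands whose exponent is not squarefree contain no squarefree monomial and are
    left out.\<close>
  define Q where "Q = {{Poly_Mapping.keys (a m)..Poly_Mapping.keys (a m) \<union> Z} | m Z.
      (m, Z) \<in> D \<and> a m = sqf (Poly_Mapping.keys (a m))}"
  have finZ: "finite Z" if "(m, Z) \<in> D" for m Z using hom[OF that] finite_subset by blast
  have sqf_cn: "sqf T \<in> cn (m, Z)"
    if "(m, Z) \<in> D" "a m = sqf (Poly_Mapping.keys (a m))" "T \<in> {Poly_Mapping.keys (a m)..Poly_Mapping.keys (a m) \<union> Z}"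
    for m Z T
  proof -
    have "finite T"
      using that(3) finZ[OF that(1)] by (meson atLeastAtMost_iff finite_UnI finite_keys finite_subset)
    then show ?thesis using that sqf_in_cone_iff by (simp add: cn_def)
  qed
  have finT: "finite T" if "T \<in> F" for T using that F by (meson Union_upper finite_atLeastAtMost finite_subset)
  have "partition_on F Q"
  proof (rule partition_onI)
    show "\<Union>Q = F"
    proof
      show "\<Union>Q \<subseteq> F"
      proof
        fix T assume "T \<in> \<Union>Q"
        then obtain m Z where mZ: "(m, Z) \<in> D" "a m = sqf (Poly_Mapping.keys (a m))"
          "T \<in> {Poly_Mapping.keys (a m)..Poly_Mapping.keys (a m) \<union> Z}" unfolding Q_def by blast
        then have "finite T"
          using finZ by (meson atLeastAtMost_iff finite_UnI finite_keys finite_subset)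
        moreover have "sqf T \<in> {e. Poly_Mapping.keys e \<in> F}" using sqf_cn[OF mZ] mZ(1) cn(2) by blast
        ultimately show "T \<in> F" by simp
      qed
      show "F \<subseteq> \<Union>Q"
      proof
        fix T assume T: "T \<in> F"
        then have "sqf T \<in> {e. Poly_Mapping.keys e \<in> F}" using finT by simp
        then have "sqf T \<in> (\<Union>d\<in>D. cn d)" using cn(2) by simp
        then obtain m Z where "(m, Z) \<in> D" "sqf T \<in> cone (a m) Z"
          by (auto simp: cn_def)
        then show "T \<in> \<Union>Q"
          using sqf_in_cone_iff[OF finT[OF T]] unfolding Q_def by blast
      qed
    qed
    fix P R assume "P \<in> Q" "R \<in> Q" "P \<noteq> R"
    then obtain m Z m' Z' where P: "P = {Poly_Mapping.keys (a m)..Poly_Mapping.keys (a m) \<union> Z}"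
      "(m, Z) \<in> D" "a m = sqf (Poly_Mapping.keys (a m))"
      and R: "R = {Poly_Mapping.keys (a m')..Poly_Mapping.keys (a m') \<union> Z'}"
      "(m', Z') \<in> D" "a m' = sqf (Poly_Mapping.keys (a m'))"
      unfolding Q_def by blast
    show "disjnt P R"
    proof (rule ccontr)
      assume "\<not> disjnt P R"
      then obtain T where "T \<in> P" "T \<in> R" unfolding disjnt_def by blast
      \<comment> \<open>A common \<open>T\<close> would put its monomial into two summands.\<close>
      then have "sqf T \<in> cn (m, Z)" "sqf T \<in> cn (m', Z')" using sqf_cn P R by auto
      then have "(m, Z) = (m', Z')"
        using disjoint_family_onD[OF cn(1) P(2) R(2)] by blast
      then show False using P R \<open>P \<noteq> R\<close> by simp
    qed
  next
    show "{} \<notin> Q" unfolding Q_def by auto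
  qed
  moreover have "\<exists>A C. P = {A..C} \<and> finite C \<and> d \<le> card C" if P: "P \<in> Q" for P
  proof -
    from P obtain m Z where mZ: "P = {Poly_Mapping.keys (a m)..Poly_Mapping.keys (a m) \<union> Z}" "(m, Z) \<in> D"
      unfolding Q_def by blast
    have "d \<le> card (Poly_Mapping.keys (a m) \<union> Z)"
      using d[OF mZ(2)] card_mono[of "Poly_Mapping.keys (a m) \<union> Z" Z] finZ[OF mZ(2)] by simp
    then show ?thesis
      using mZ(1) finZ[OF mZ(2)]
      by (intro exI[of _ "Poly_Mapping.keys (a m)"] exI[of _ "Poly_Mapping.keys (a m) \<union> Z"]) simp
  qed
  ultimately show ?thesis unfolding has_interval_partition_def by blast
qed

text \<open>The monomials with support in \<open>{A..C}\<close> are exactly those of \<open>x\<^sup>A K[C]\<close>.\<close>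

lemma stanley_decomposition_if_interval_partition:
  assumes "has_interval_partition d F" and F: "\<Union>F \<subseteq> {1..p}"
  obtains D :: "('k::field mpoly \<times> nat set) set"
  where "stanley_decomposition p (support_module F) D" "\<And>m Z. (m, Z) \<in> D \<Longrightarrow> d \<le> card Z"
proof -
  obtain Q where Q: "partition_on F Q" "\<forall>P\<in>Q. \<exists>A C. P = {A..C} \<and> finite C \<and> d \<le> card C"
    using assms(1) unfolding has_interval_partition_def by blast
  then obtain lo hi where lh: "\<And>P. P \<in> Q \<Longrightarrow> P = {lo P..hi P} \<and> finite (hi P) \<and> d \<le> card (hi P)"
    by metis
  have QF: "\<Union>Q = F" "{} \<notin> Q" using Q(1) by (auto simp: partition_on_def)
  have sub: "lo P \<subseteq> hi P" if "P \<in> Q" for P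
    using lh[OF that] that QF(2) by (metis atLeastatMost_empty_iff2)
  have finlo: "finite (lo P)" if "P \<in> Q" for P
    using sub[OF that] lh[OF that] finite_subset by blast
  have inF: "lo P \<in> F" "hi P \<in> F" if "P \<in> Q" for P
  proof -
    have "lo P \<in> {lo P..hi P}" "hi P \<in> {lo P..hi P}" using sub[OF that] by auto
    then show "lo P \<in> F" "hi P \<in> F" using lh[OF that] that QF(1) by blast+
  qed
  have "finite F" by (rule finite_subset[of _ "Pow {1..p}"]) (use F in auto)
  then have finQ: "finite Q" using QF(1) by (simp add: finite_UnionD)
  define D :: "('k mpoly \<times> nat set) set" where
    "D = (\<lambda>P. (Poly_Mapping.single (sqf (lo P)) 1, hi P)) ` Q"
  \<comment> \<open>The cones have to be indexed by the pairs in \<open>D\<close>; \<open>ex\<close>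
    reads the exponent off a monomial as its only key.\<close>
  define ex :: "'k mpoly \<Rightarrow> nat \<Rightarrow>\<^sub>0 nat" where "ex = (\<lambda>m. the_elem (Poly_Mapping.keys m))"
  have ex: "ex (Poly_Mapping.single e 1) = e" for e by (simp add: ex_def)
  define cn where "cn = (\<lambda>d. case d of (m, Z) \<Rightarrow> cone (ex m) Z)"
  have cnP: "e \<in> cn (Poly_Mapping.single (sqf (lo P)) 1, hi P) \<longleftrightarrow> Poly_Mapping.keys e \<in> P" if "P \<in> Q" for P e
    using in_cone_sqf_iff[OF sub[OF that] finlo[OF that]] lh[OF that] by (simp add: cn_def ex)
  have "disjoint_family_on cn D"
    unfolding disjoint_family_on_def
  proof (intro ballI impI, rule ccontr)
    fix x y assume xy: "x \<in> D" "y \<in> D" "x \<noteq> y" "cn x \<inter> cn y \<noteq> {}"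
    then obtain P R e where PR: "P \<in> Q" "R \<in> Q" "x = (Poly_Mapping.single (sqf (lo P)) 1, hi P)"
      "y = (Poly_Mapping.single (sqf (lo R)) 1, hi R)" "e \<in> cn x" "e \<in> cn y"
      unfolding D_def by blast
    then have "P = R" using partition_on_part_unique[OF Q(1)] cnP by metis
    then show False using PR xy by simp
  qed
  moreover have "(\<Union>d\<in>D. cn d) = {e. Poly_Mapping.keys e \<in> F}"
    unfolding QF(1)[symmetric] D_def using cnP by auto
  ultimately have "bij_betw (\<lambda>g. \<Sum>d\<in>D. g d) (\<Pi>\<^sub>E d\<in>D. monomial_subspace (cn d)) (support_module F :: 'k mpoly set)"
    unfolding support_module_def using finQ by (intro bij_betw_sum_monomial_subspaces) (simp_all add: D_def)
  moreover have "(\<Pi>\<^sub>E (m, Z)\<in>D. stanley_space m Z) = (\<Pi>\<^sub>E d\<in>D. monomial_subspace (cn d))"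
    unfolding cn_def by (rule PiE_stanley_spaces_single[where c = "\<lambda>_. 1"]) (auto simp: D_def ex)
  ultimately have bij: "bij_betw (\<lambda>g. \<Sum>d\<in>D. g d) (\<Pi>\<^sub>E (m, Z)\<in>D. stanley_space m Z) (support_module F)"
    by simp
  have "m \<in> support_module F \<and> homogeneous m \<and> Z \<subseteq> {1..p} \<and> m \<noteq> 0 \<and> d \<le> card Z" if mZ: "(m, Z) \<in> D" for m Z
  proof -
    from mZ obtain P where P: "P \<in> Q" "m = Poly_Mapping.single (sqf (lo P)) 1" "Z = hi P"
      unfolding D_def by blast
    have "m \<noteq> 0" unfolding P(2) by (metis lookup_single_eq lookup_zero zero_neq_one)
    then show ?thesis
      using inF[OF P(1)] lh[OF P(1)] finlo[OF P(1)] F P(2,3)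
      by (auto simp: support_module_def homogeneous_def)
  qed
  \<comment> \<open>Freeness follows from \<open>m \<noteq> 0\<close>, as the polynomial ring has no
    zero divisors.\<close>
  then have "stanley_decomposition p (support_module F) D" "\<And>m Z. (m, Z) \<in> D \<Longrightarrow> d \<le> card Z"
    using bij finQ unfolding stanley_decomposition_def by (auto simp: D_def)
  then show ?thesis using that by blast
qed

section \<open>Intersections of monomial prime ideals in disjoint variables\<close>

text \<open>The monomials in the variables \<open>U\<close> that involve a variable of
  \<open>V\<close> span an ideal containing these variables, which gives one inclusion by
  minimality. For the other, such a monomial is a multiple of some \<open>pvar i\<close> with
  \<open>i\<close> in \<open>V\<close>.\<close>

lemma genideal_pvar:
  fixes U V :: "nat set"
  assumes "V \<subseteq> U"
  shows "Idl\<^bsub>poly_ring U\<^esub> (pvar ` V) =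
    (monomial_subspace {a. Poly_Mapping.keys a \<subseteq> U \<and> Poly_Mapping.keys a \<inter> V \<noteq> {}} :: 'k::field mpoly set)"
    (is "_ = ?M")
proof
  interpret R: cring "poly_ring U :: 'k mpoly ring" by (rule cring_poly_ring)
  have M: "f \<in> ?M \<longleftrightarrow> (\<forall>a\<in>Poly_Mapping.keys f. Poly_Mapping.keys a \<subseteq> U \<and> Poly_Mapping.keys a \<inter> V \<noteq> {})"
    for f :: "'k mpoly" by (auto simp: monomial_subspace_def)
  have pvar_carrier: "pvar ` V \<subseteq> carrier (poly_ring U :: 'k mpoly ring)"
    using assms by (auto simp: pvar_def carrier_poly_ring)
  have mult_M: "g * f \<in> ?M" if "f \<in> ?M" "g \<in> carrier (poly_ring U)" for f g :: "'k mpoly"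
    unfolding M
  proof
    fix a assume "a \<in> Poly_Mapping.keys (g * f)"
    then obtain b c where bc: "a = b + c" "b \<in> Poly_Mapping.keys g" "c \<in> Poly_Mapping.keys f"
      using keys_mult[of g f] by blast
    have "Poly_Mapping.keys a = Poly_Mapping.keys b \<union> Poly_Mapping.keys c"
      unfolding bc(1) by (auto simp: in_keys_iff lookup_add)
    moreover have "Poly_Mapping.keys b \<subseteq> U"
      using bc(2) that(2) by (simp add: carrier_poly_ring)
    moreover have "Poly_Mapping.keys c \<subseteq> U \<and> Poly_Mapping.keys c \<inter> V \<noteq> {}"
      using bc(3) that(1) unfolding M by simp
    ultimately show "Poly_Mapping.keys a \<subseteq> U \<and> Poly_Mapping.keys a \<inter> V \<noteq> {}"
      by auto
  qed
  have "ideal ?M (poly_ring U)"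
  proof (rule idealI)
    show "ring (poly_ring U :: 'k mpoly ring)" by (rule R.ring_axioms)
    show "subgroup ?M (add_monoid (poly_ring U))"
    proof (rule R.add.subgroupI)
      show "?M \<subseteq> carrier (poly_ring U)" by (auto simp: M carrier_poly_ring)
      have "0 \<in> ?M" by simp
      then show "?M \<noteq> {}" by blast
      fix f g assume f: "f \<in> ?M"
      then have "\<ominus>\<^bsub>poly_ring U\<^esub> f = - f"
        by (intro R.minus_equality) (auto simp: M carrier_poly_ring)
      then show "\<ominus>\<^bsub>poly_ring U\<^esub> f \<in> ?M" using f by (simp add: M)
      assume "g \<in> ?M"
      then show "f \<oplus>\<^bsub>poly_ring U\<^esub> g \<in> ?M"
        using f Poly_Mapping.keys_add[of f g] by (auto simp: M)
    qed
    show "g \<otimes>\<^bsub>poly_ring U\<^esub> f \<in> ?M" "f \<otimes>\<^bsub>poly_ring U\<^esub> g \<in> ?M"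
      if "f \<in> ?M" "g \<in> carrier (poly_ring U)" for f g
      using mult_M[OF that] by (simp_all add: mult.commute)
  qed
  moreover have "pvar ` V \<subseteq> ?M" using assms by (auto simp: pvar_def)
  ultimately show "Idl\<^bsub>poly_ring U\<^esub> (pvar ` V) \<subseteq> ?M" by (rule R.genideal_minimal)
  let ?J = "Idl\<^bsub>poly_ring U\<^esub> (pvar ` V :: 'k mpoly set)"
  interpret I: ideal ?J "poly_ring U :: 'k mpoly ring"
    by (rule R.genideal_ideal[OF pvar_carrier])
  show "?M \<subseteq> ?J"
  proof
    fix f :: "'k mpoly" assume "f \<in> ?M"
    then have "Poly_Mapping.keys f \<subseteq> {a. Poly_Mapping.keys a \<subseteq> U \<and> Poly_Mapping.keys a \<inter> V \<noteq> {}}"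
      by (simp add: monomial_subspace_def)
    then show "f \<in> ?J"
    proof (rule poly_mapping_monomial_induct)
      show "0 \<in> ?J" using I.zero_closed by simp
      show "g + h \<in> ?J"
        if "g \<in> ?J" "h \<in> ?J" for g h :: "'k mpoly"
        using I.a_closed[OF that] by simp
      fix a :: "nat \<Rightarrow>\<^sub>0 nat" and x :: 'k
      assume "a \<in> {a. Poly_Mapping.keys a \<subseteq> U \<and> Poly_Mapping.keys a \<inter> V \<noteq> {}}"
      then obtain i where a: "Poly_Mapping.keys a \<subseteq> U" "i \<in> Poly_Mapping.keys a" "i \<in> V" by blast
      let ?b = "a - Poly_Mapping.single i 1"
      have "a = ?b + Poly_Mapping.single i 1"
        using a(2) by (intro poly_mapping_eqI)
          (auto simp: lookup_add minus_poly_mapping.rep_eq lookup_single when_def in_keys_iff)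
      then have "Poly_Mapping.single a x = Poly_Mapping.single ?b x * pvar i"
        by (simp add: pvar_def mult_single)
      moreover have "Poly_Mapping.keys ?b \<subseteq> U"
        using a(1) by (auto simp: in_keys_iff minus_poly_mapping.rep_eq)
      then have "Poly_Mapping.single ?b x \<in> carrier (poly_ring U)"
        by (simp add: carrier_poly_ring)
      moreover have "pvar i \<in> ?J"
        using R.genideal_self[OF pvar_carrier] a(3) by blast
      ultimately show "Poly_Mapping.single a x \<in> ?J"
        using I.I_l_closed by fastforce
    qed
  qed
qed

lemma prod_pvar: "finite T \<Longrightarrow> (\<Prod>i\<in>T. pvar i) = Poly_Mapping.single (sqf T) 1"
  by (induction T rule: finite_induct) (simp_all add: sqf_def pvar_def mult_single)

section \<open>Both depths in terms of the family of supports\<close>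

lemma alpha_support_module:
  assumes "\<Union>F \<subseteq> {1..p}"
  shows "alpha p (support_module F :: 'k::field mpoly set) {0} j = card {T \<in> F. card T = j}"
proof -
  let ?mon = "\<lambda>T. Poly_Mapping.single (sqf T) (1::'k)"
  have fin: "finite T" if "T \<subseteq> {1..p}" for T using that finite_subset by blast
  have FT: "T \<subseteq> {1..p}" if "T \<in> F" for T using that assms by blast
  have nz: "?mon T \<noteq> 0" for T by (metis lookup_single_eq lookup_zero zero_neq_one)
  have "{m \<in> support_module F - {0}. \<exists>T. T \<subseteq> {1..p} \<and> card T = j \<and> m = (\<Prod>i\<in>T. pvar i)}
      = ?mon ` {T \<in> F. card T = j}"
  proof (intro Set.set_eqI iffI)
    fix m :: "'k mpoly"
    assume "m \<in> {m \<in> support_module F - {0}. \<exists>T. T \<subseteq> {1..p} \<and> card T = j \<and> m = (\<Prod>i\<in>T. pvar i)}"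
    then obtain T where T: "m \<in> support_module F" "T \<subseteq> {1..p}" "card T = j" "m = (\<Prod>i\<in>T. pvar i)"
      by blast
    then have "m = ?mon T" using prod_pvar[OF fin] by blast
    moreover from this have "T \<in> F" using T(1) fin[OF T(2)] by (simp add: support_module_def)
    ultimately show "m \<in> ?mon ` {T \<in> F. card T = j}" using T(3) by blast
  next
    fix m :: "'k mpoly"
    assume "m \<in> ?mon ` {T \<in> F. card T = j}"
    then obtain T where T: "m = ?mon T" "T \<in> F" "card T = j" by blast
    then show "m \<in> {m \<in> support_module F - {0}. \<exists>T. T \<subseteq> {1..p} \<and> card T = j \<and> m = (\<Prod>i\<in>T. pvar i)}"
      using fin[OF FT[OF T(2)]] FT[OF T(2)] nz[of T] prod_pvar[of T, where 'a = 'k]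
      by (auto simp: support_module_def)
  qed
  moreover have "inj_on ?mon {T \<in> F. card T = j}"
  proof (rule inj_onI)
    fix T U assume TU: "T \<in> {T \<in> F. card T = j}" "U \<in> {T \<in> F. card T = j}" "?mon T = ?mon U"
    have "Poly_Mapping.keys (?mon T) = Poly_Mapping.keys (?mon U)" using TU(3) by simp
    then have "sqf T = sqf U" by simp
    moreover have "finite T" "finite U" using TU fin FT by blast+
    ultimately show "T = U" by (metis keys_sqf)
  qed
  ultimately show ?thesis unfolding alpha_def by (simp add: card_image)
qed

text \<open>The top of a part is itself a member of \<open>F\<close>, hence a subset of
  \<open>X\<close>. This bounds the depths over which maxima are taken.\<close>

lemma has_interval_partition_le_card:
  assumes "has_interval_partition d F" "F \<noteq> {}" "\<Union>F \<subseteq> X" "finite X"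
  shows "d \<le> card X"
proof -
  obtain Q where Q: "partition_on F Q" "\<forall>P\<in>Q. \<exists>A C. P = {A..C} \<and> finite C \<and> d \<le> card C"
    using assms(1) unfolding has_interval_partition_def by blast
  obtain T where "T \<in> F" using assms(2) by blast
  then obtain P where P: "P \<in> Q" "T \<in> P" using partition_onD1[OF Q(1)] by blast
  then obtain A C where AC: "P = {A..C}" "d \<le> card C" using Q(2) by blast
  have "C \<in> P" using P(2) AC(1) by auto
  then have "C \<in> F" using P(1) partition_onD1[OF Q(1)] by blast
  then have "C \<subseteq> X" using assms(3) by blast
  then show ?thesis using AC(2) card_mono[OF assms(4)] le_trans by blast
qed

text \<open>Combines the two translations: every decomposition yields an interval partition of its
  depth, and the given partition yields a decomposition. The second claim says that the maximum is
  attained.\<close>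

lemma sdepth_support_module:
  fixes F :: "nat set set"
  assumes "has_interval_partition d F" "F \<noteq> {}" and F: "\<Union>F \<subseteq> {1..p}"
  shows "d \<le> sdepth p (support_module F :: 'k::field mpoly set)"
    and "has_interval_partition (sdepth p (support_module F :: 'k mpoly set)) F"
proof -
  let ?M = "support_module F :: 'k mpoly set"
  define X where "X = {sdepth_decomposition D | D. stanley_decomposition p ?M D}"
  have partition: "has_interval_partition x F" if x: "x \<in> X" for x
  proof -
    from x obtain D where D: "stanley_decomposition p ?M D" "x = sdepth_decomposition D"
      unfolding X_def by blast
    have "finite D" using D(1) by (simp add: stanley_decomposition_def)
    then have "x \<le> card Z" if "(m, Z) \<in> D" for m Z
      unfolding D(2) sdepth_decomposition_def using that by (intro Min_le) force+
    then show ?thesis using interval_partition_if_stanley_decomposition[OF D(1) F] by blast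
  qed
  then have "x \<le> p" if "x \<in> X" for x
    using has_interval_partition_le_card[OF partition[OF that] assms(2) F] by simp
  \<comment> \<open>The values are bounded by \<open>p\<close>, so \<open>Max\<close> is a true
    maximum.\<close>
  then have finX: "finite X" by (meson finite_nat_set_iff_bounded_le)
  obtain D :: "('k mpoly \<times> nat set) set" where D: "stanley_decomposition p ?M D"
    "\<And>m Z. (m, Z) \<in> D \<Longrightarrow> d \<le> card Z"
    using stanley_decomposition_if_interval_partition[OF assms(1) F] by blast
  \<comment> \<open>\<open>Min\<close> is meaningful only for nonempty \<open>D\<close>. An empty
    \<open>D\<close> satisfies every lower bound vacuously, in particular \<open>Suc p\<close>,
    which exceeds the size of the ground set.\<close>
  have "D \<noteq> {}"
  proof
    assume "D = {}"
    then have "has_interval_partition (Suc p) F"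
      using interval_partition_if_stanley_decomposition[OF D(1) F] by blast
    then show False using has_interval_partition_le_card[of "Suc p" F "{1..p}"] assms(2) F by simp
  qed
  moreover have "finite D" using D(1) by (simp add: stanley_decomposition_def)
  ultimately have "d \<le> sdepth_decomposition D"
    unfolding sdepth_decomposition_def using D(2) by (subst Min_ge_iff) auto
  moreover have "sdepth_decomposition D \<in> X" using D(1) X_def by blast
  ultimately show "d \<le> sdepth p ?M" "has_interval_partition (sdepth p ?M) F"
    unfolding sdepth_def X_def[symmetric]
    using Max_ge[OF finX] Max_in[OF finX] partition by (blast intro: le_trans)+
qed

lemma ceiling_half_nat: "\<lceil>real m / 2\<rceil> = int ((m + 1) div 2)"
proof (cases "even m")
  case True
  then obtain b where "m = 2 * b" by blast
  then show ?thesis by simp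
next
  case False
  then obtain b where "m = 2 * b + 1" by (rule oddE)
  then show ?thesis by (intro ceiling_unique) (simp_all add: add_divide_distrib)
qed

section \<open>Blocks of variables and the theorem\<close>

definition block :: "(nat \<Rightarrow> nat) \<Rightarrow> nat \<Rightarrow> nat set" where
  "block n k = {(\<Sum>i=1..<k. n i) + 1..(\<Sum>i=1..k. n i)}"

lemma card_block: "1 \<le> k \<Longrightarrow> card (block n k) = n k"
  by (cases k) (simp_all add: block_def atLeastLessThanSuc_atLeastAtMost)

lemma UN_block: "(\<Union>k\<in>{1..r}. block n k) = {1..\<Sum>i=1..r. n i}"
proof (induction r)
  case (Suc r)
  have "(\<Union>k\<in>{1..Suc r}. block n k) = {1..\<Sum>i=1..r. n i} \<union> block n (Suc r)"
    using Suc by (simp add: atLeastAtMostSuc_conv Un_commute)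
  also have "\<dots> = {1..\<Sum>i=1..Suc r. n i}"
    by (auto simp: block_def atLeastLessThanSuc_atLeastAtMost)
  finally show ?case .
qed simp

lemma disjoint_family_block: "disjoint_family_on (block n) {1..r}"
proof -
  have "block n i \<inter> block n j = {}" if "1 \<le> i" "i < j" for i j
  proof -
    have "(\<Sum>i=1..i. n i) \<le> (\<Sum>i=1..<j. n i)"
      using that by (intro sum_mono2) auto
    then show ?thesis by (auto simp: block_def)
  qed
  then show ?thesis
    unfolding disjoint_family_on_def by (metis Int_commute atLeastAtMost_iff linorder_neqE_nat)
qed

theorem theorem3p3:
  fixes r N :: nat and n :: "nat \<Rightarrow> nat" and I :: "'k::field mpoly set"
  assumes "r \<ge> 1"
    and "\<And>i. i \<in> {1..r} \<Longrightarrow> n i \<ge> 1"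
    and "N = (\<Sum>i=1..r. n i)"
    and "I = (\<Inter>k\<in>{1..r}. Idl\<^bsub>poly_ring {1..N}\<^esub> (pvar ` {(\<Sum>i=1..<k. n i) + 1 .. (\<Sum>i=1..k. n i)}))"
  shows "\<lfloor>real (N + r) / 2\<rfloor> \<ge> int (hdepth N I)
    \<and> hdepth N I \<ge> sdepth N I
    \<and> int (sdepth N I) \<ge> (\<Sum>i=1..r. \<lceil>real (n i) / 2\<rceil>)"
proof -
  define F where "F = meeting_all (block n) {1..r}"
  have UN: "(\<Union>k\<in>{1..r}. block n k) = {1..N}" using UN_block assms(3) by simp
  have FN: "\<Union>F \<subseteq> {1..N}" unfolding F_def meeting_all_def UN by blast
  have finF: "finite F" by (rule finite_subset[of _ "Pow {1..N}"]) (use FN in auto)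
  have block: "finite (block n k)" "block n k \<noteq> {}" "card (block n k) = n k" if "k \<in> {1..r}" for k
    using card_block[of k n] assms(2)[OF that] that by (auto simp: block_def card_gt_0_iff)
  have "F \<noteq> {}"
    using transversal_exists[of "{1..r}" "block n"] disjoint_family_block block unfolding F_def by fastforce
  have I: "I = support_module F"
  proof -
    have "I = (\<Inter>k\<in>{1..r}. monomial_subspace {a. Poly_Mapping.keys a \<subseteq> {1..N} \<and> Poly_Mapping.keys a \<inter> block n k \<noteq> {}})"
      unfolding assms(4) block_def[symmetric] by (rule INF_cong) (use UN in \<open>auto intro!: genideal_pvar\<close>)
    \<comment> \<open>A polynomial lies in all the prime ideals iff the support of each of its
      monomials meets every block. As \<open>r \<ge> 1\<close>, the intersection has a member, which
      confines the supports to \<open>{1..N}\<close>.\<close>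
    also have "\<dots> = support_module F"
      using assms(1) unfolding support_module_def monomial_subspace_def F_def meeting_all_def UN by fastforce
    finally show ?thesis .
  qed
  have "has_interval_partition (\<Sum>i=1..r. (card (block n i) + 1) div 2) F"
    unfolding F_def using disjoint_family_block block by (intro has_interval_partition_meeting_all) auto
  moreover have "(\<Sum>i=1..r. (card (block n i) + 1) div 2) = (\<Sum>i=1..r. (n i + 1) div 2)"
    using block by (intro sum.cong) auto
  ultimately have "has_interval_partition (\<Sum>i=1..r. (n i + 1) div 2) F" by simp
  note sdepth = sdepth_support_module[OF this \<open>F \<noteq> {}\<close> FN, where 'k = 'k, folded I]
  define H where "H = {d \<in> {0..N}. \<forall>k\<le>d. 0 \<le> beta_of (\<lambda>j. card {T \<in> F. card T = j}) d k}"
  have hdepth: "hdepth N I = Max H"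
    unfolding hdepth_def hdepth_quotient_def H_def beta_def beta_of_def I
      alpha_support_module[OF FN] ..
  \<comment> \<open>The partition that attains the Stanley depth makes all coefficients nonnegative
    at \<open>d = sdepth N I\<close>, so this number competes in the maximum defining
    \<open>hdepth\<close>.\<close>
  have "sdepth N I \<in> H"
    using beta_of_interval_partition_nonneg[OF sdepth(2) finF]
      has_interval_partition_le_card[OF sdepth(2) \<open>F \<noteq> {}\<close> FN] by (simp add: H_def)
  moreover have "finite H" by (simp add: H_def)
  ultimately have "sdepth N I \<le> hdepth N I" "hdepth N I \<in> H"
    unfolding hdepth by (auto intro: Max_ge Max_in)
  moreover have "2 * hdepth N I \<le> N + card {1..r}"
    using \<open>hdepth N I \<in> H\<close> block disjoint_family_block UN unfolding H_def F_def
    by (intro meeting_all_depth_bound[of "{1..r}" "block n"]) auto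
  then have "int (hdepth N I) \<le> \<lfloor>real (N + r) / 2\<rfloor>"
    by (simp add: le_floor_iff)
  moreover have "(\<Sum>i=1..r. \<lceil>real (n i) / 2\<rceil>) \<le> int (sdepth N I)"
    using sdepth(1) unfolding ceiling_half_nat by (simp flip: of_nat_sum)
  ultimately show ?thesis by simp
qed

end
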